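(* Let $\Gamma$ be a finitely generated right-angled Coxeter group with finite Coxeter generating set $S$ and chromatic number $n$, let $T$ be an exponentially branching locally compact simplicial tree, and let $r>0$ be a number. Then there exists a bilipschitz embedding $$\psi: C(\Gamma,S)\to T\times\cdots\times T\quad (n\text{ factors})$$ such that $\psi$ restricted to every ball of radius $r$ is isometric.
   Context: A finitely generated right-angled Coxeter group is a group $\Gamma$ together with a finite set $S$ of generators such that every element of $S$ has order two and all relations in $\Gamma$ are consequences of these and of relations of the form $st=ts$ with $s,t\in S$. A colouring is a map $c:S\to\{1,\dots,n\}$ such that $c(s)\neq c(t)$ for all distinct $s,t\in S$ with $st=ts$; the chromatic number of $\Gamma$ is the minimal number $n$ of colours needed. The Cayley graph $C(\Gamma,S)$ has vertex set $\Gamma$ and an edge between $\gamma$ and $\gamma s$ for each $\gamma\in\Gamma$, $s\in S$. Graphs and trees always carry the simplicial metric, in which every edge has length $1$. A product of trees carries the $l_1$-product metric, i.e. the distance is the sum of the distances in the factors. A pointed simplicial tree $(T,t_0)$ is called exponentially branching if there exists a number $\sigma>0$ such that every vertex $t\in T$ has more than $e^{\sigma d(t,t_0)}$ neighbours, where $d$ is the metric on $T$; a tree $T$ is called exponentially branching if it is so for some base vertex $t_0$. A map $f$ between metric spaces is a bilipschitz embedding if there is $L\ge 1$ with $L^{-1}d(x,y)\le d(f(x),f(y))\le L\,d(x,y)$ for all $x,y$.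
   Formalization: The Cayley graph, the trees and the balls are taken as vertex sets with the path metric; on the full metric graph, with points inside edges, isometry on balls fails, e.g. for Z/2 x Z/2 and r = 2, whose Cayley graph is a circle of length 4 that has no isometric map to a product of trees. *)

theory Defs
  imports "HOL-Analysis.Analysis" "HOL-Algebra.Generated_Groups" "HOL-Algebra.Multiplicative_Group"
begin

definition word_value :: "('g, 'm) monoid_scheme \<Rightarrow> 'g list \<Rightarrow> 'g"
  where "word_value G w = foldr (mult G) w (one G)"

text \<open>
  The congruence on words over \<open>S\<close> generated by \<open>s s = 1\<close> and by those relations \<open>s t = t s\<close>
  with \<open>s, t \<in> S\<close> that hold in \<open>G\<close>. Formal inverses of letters are not needed, because the relations
  \<open>s s = 1\<close> make every generator its own inverse; so this presents the same group as the
  corresponding quotient of the free group on \<open>S\<close>.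
\<close>

inductive coxeter_consequence :: "('g, 'm) monoid_scheme \<Rightarrow> 'g set \<Rightarrow> 'g list \<Rightarrow> 'g list \<Rightarrow> bool"
  for G :: "('g, 'm) monoid_scheme" and S :: "'g set" where
  refl: "coxeter_consequence G S w w"
| sym: "coxeter_consequence G S v w \<Longrightarrow> coxeter_consequence G S w v"
| trans: "coxeter_consequence G S u v \<Longrightarrow> coxeter_consequence G S v w \<Longrightarrow> coxeter_consequence G S u w"
| square: "s \<in> S \<Longrightarrow> coxeter_consequence G S (u @ [s, s] @ v) (u @ v)"
| commute: "s \<in> S \<Longrightarrow> t \<in> S \<Longrightarrow> s \<otimes>\<^bsub>G\<^esub> t = t \<otimes>\<^bsub>G\<^esub> s \<Longrightarrow>
    coxeter_consequence G S (u @ [s, t] @ v) (u @ [t, s] @ v)"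

definition right_angled_coxeter_group :: "('g, 'm) monoid_scheme \<Rightarrow> 'g set \<Rightarrow> bool"
  where "right_angled_coxeter_group G S \<longleftrightarrow>
    group G \<and> finite S \<and> S \<subseteq> carrier G \<and> generate G S = carrier G \<and>
    (\<forall>s\<in>S. group.ord G s = 2) \<and>
    (\<forall>v\<in>lists S. \<forall>w\<in>lists S. word_value G v = word_value G w \<longrightarrow> coxeter_consequence G S v w)"

definition colouring :: "('g, 'm) monoid_scheme \<Rightarrow> 'g set \<Rightarrow> nat \<Rightarrow> ('g \<Rightarrow> nat) \<Rightarrow> bool"
  where "colouring G S n c \<longleftrightarrow> c \<in> S \<rightarrow> {1..n} \<and>
    (\<forall>s\<in>S. \<forall>t\<in>S. s \<noteq> t \<and> s \<otimes>\<^bsub>G\<^esub> t = t \<otimes>\<^bsub>G\<^esub> s \<longrightarrow> c s \<noteq> c t)"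

definition chromatic_number :: "('g, 'm) monoid_scheme \<Rightarrow> 'g set \<Rightarrow> nat"
  where "chromatic_number G S = (LEAST n. \<exists>c. colouring G S n c)"

text \<open>
  A graph is given by its vertex set \<open>V\<close> and its adjacency relation \<open>E\<close>. Its simplicial metric is
  regarded as a metric on the vertex set: the length of a shortest edge path. Local isometry of an
  embedding of a Cayley graph is only meaningful there: the realization of a 4-cycle does not embed
  isometrically in any \<open>l\<^sub>1\<close>-product of trees.
\<close>

definition graph_dist :: "('v \<Rightarrow> 'v \<Rightarrow> bool) \<Rightarrow> 'v \<Rightarrow> 'v \<Rightarrow> real"
  where "graph_dist E x y = real (LEAST k. (E ^^ k) x y)"

definition cayley_adj :: "('g, 'm) monoid_scheme \<Rightarrow> 'g set \<Rightarrow> 'g \<Rightarrow> 'g \<Rightarrow> bool"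
  where "cayley_adj G S x y \<longleftrightarrow> x \<in> carrier G \<and> (\<exists>s\<in>S. y = x \<otimes>\<^bsub>G\<^esub> s)"

definition simple_graph :: "'v set \<Rightarrow> ('v \<Rightarrow> 'v \<Rightarrow> bool) \<Rightarrow> bool"
  where "simple_graph V E \<longleftrightarrow> (\<forall>x y. E x y \<longrightarrow> x \<in> V \<and> y \<in> V \<and> x \<noteq> y \<and> E y x)"

definition graph_cycle :: "('v \<Rightarrow> 'v \<Rightarrow> bool) \<Rightarrow> 'v list \<Rightarrow> bool"
  where "graph_cycle E p \<longleftrightarrow> 3 \<le> length p \<and> distinct p \<and> successively E p \<and> E (last p) (hd p)"

definition simplicial_tree :: "'v set \<Rightarrow> ('v \<Rightarrow> 'v \<Rightarrow> bool) \<Rightarrow> bool"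
  where "simplicial_tree V E \<longleftrightarrow> simple_graph V E \<and> V \<noteq> {} \<and>
    (\<forall>x\<in>V. \<forall>y\<in>V. E\<^sup>*\<^sup>* x y) \<and> (\<nexists>p. graph_cycle E p)"

text \<open>A vertex with infinitely many neighbours counts as having more than any given number of them.\<close>

definition exponentially_branching_at :: "'v set \<Rightarrow> ('v \<Rightarrow> 'v \<Rightarrow> bool) \<Rightarrow> 'v \<Rightarrow> bool"
  where "exponentially_branching_at V E t0 \<longleftrightarrow>
    (\<exists>\<sigma>>0. \<forall>t\<in>V. infinite {u. E t u} \<or> real (card {u. E t u}) > exp (\<sigma> * graph_dist E t t0))"

definition exponentially_branching :: "'v set \<Rightarrow> ('v \<Rightarrow> 'v \<Rightarrow> bool) \<Rightarrow> bool"
  where "exponentially_branching V E \<longleftrightarrow> (\<exists>t0\<in>V. exponentially_branching_at V E t0)"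

text \<open>
  Local compactness refers to the geometric realization, in which every edge is a unit interval (the
  vertex set alone is discrete). A point of the realization is given by its barycentric coordinates,
  supported on a vertex or on the two ends of an edge. The distance is affine on each edge; for two
  points with no common edge, a shortest path leaves \<open>p\<close> through an end \<open>x\<close> of its edge (at distance
  \<open>1 - p x\<close> from \<open>p\<close>) and reaches \<open>q\<close> through an end \<open>y\<close> of its edge.
\<close>

definition realization :: "'v set \<Rightarrow> ('v \<Rightarrow> 'v \<Rightarrow> bool) \<Rightarrow> ('v \<Rightarrow> real) set"
  where "realization V E = {p. (\<forall>v. 0 \<le> p v) \<and>
    (\<exists>x\<in>V. \<exists>y\<in>V. (x = y \<or> E x y) \<and> (\<forall>v. v \<notin> {x, y} \<longrightarrow> p v = 0) \<and> sum p {x, y} = 1)}"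

definition supp :: "('v \<Rightarrow> real) \<Rightarrow> 'v set"
  where "supp p = {v. p v \<noteq> 0}"

definition realization_dist :: "('v \<Rightarrow> 'v \<Rightarrow> bool) \<Rightarrow> ('v \<Rightarrow> real) \<Rightarrow> ('v \<Rightarrow> real) \<Rightarrow> real"
  where "realization_dist E p q =
    (if \<exists>x y. E x y \<and> supp p \<union> supp q \<subseteq> {x, y}
     then (\<Sum>v \<in> supp p \<union> supp q. \<bar>p v - q v\<bar>) / 2
     else Min {(1 - p x) + graph_dist E x y + (1 - q y) | x y. x \<in> supp p \<and> y \<in> supp q})"

definition locally_compact_graph :: "'v set \<Rightarrow> ('v \<Rightarrow> 'v \<Rightarrow> bool) \<Rightarrow> bool"
  where "locally_compact_graph V E \<longleftrightarrow>
    locally_compact_space (Metric_space.mtopology (realization V E) (realization_dist E))"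

text \<open>The \<open>n\<close>-fold product of \<open>V\<close> is \<open>{1..n} \<rightarrow>\<^sub>E V\<close>.\<close>

definition l1_dist :: "nat \<Rightarrow> ('v \<Rightarrow> 'v \<Rightarrow> real) \<Rightarrow> (nat \<Rightarrow> 'v) \<Rightarrow> (nat \<Rightarrow> 'v) \<Rightarrow> real"
  where "l1_dist n d f g = (\<Sum>i = 1..n. d (f i) (g i))"

definition bilipschitz_embedding ::
    "'a set \<Rightarrow> ('a \<Rightarrow> 'a \<Rightarrow> real) \<Rightarrow> 'b set \<Rightarrow> ('b \<Rightarrow> 'b \<Rightarrow> real) \<Rightarrow> ('a \<Rightarrow> 'b) \<Rightarrow> bool"
  where "bilipschitz_embedding X dX Y dY f \<longleftrightarrow> f \<in> X \<rightarrow> Y \<and>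
    (\<exists>L\<ge>1. \<forall>x\<in>X. \<forall>y\<in>X. inverse L * dX x y \<le> dY (f x) (f y) \<and> dY (f x) (f y) \<le> L * dX x y)"

definition isometric_on ::
    "'a set \<Rightarrow> ('a \<Rightarrow> 'a \<Rightarrow> real) \<Rightarrow> ('b \<Rightarrow> 'b \<Rightarrow> real) \<Rightarrow> ('a \<Rightarrow> 'b) \<Rightarrow> bool"
  where "isometric_on B dX dY f \<longleftrightarrow> (\<forall>x\<in>B. \<forall>y\<in>B. dY (f x) (f y) = dX x y)"

end

theory Submission
  imports Defs
begin

text \<open>
  Fix a colouring \<open>c\<close> with \<open>n\<close> colours. A word spells a path in the Cayley graph; for a colour \<open>i\<close> list the
  walls (reflections \<open>g s g\<inverse>\<close> with \<open>c s = i\<close>) that the path crosses. Commuting generators have different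
  colours, so up to cancellation of adjacent equal entries the list depends only on the endpoint, and a
  reduced word crosses no wall twice. Hence the \<open>n\<close> lists embed the group isometrically into a product of
  \<open>n\<close> (locally infinite) trees of lists. It remains to fold each of them into \<open>T\<close>, sending the list \<open>X\<close> to the
  vertex reached from a fixed vertex far from the root by the sequence of labels of its entries, where level
  \<open>k\<close> may use about \<open>e\<^sup>\<sigma>\<^sup>k\<close> labels.

  Reducing the integral reflection representation modulo \<open>3\<^sup>2\<^sup>R\<^sup>+\<^sup>1\<close> colours all walls with exponentially many
  (in \<open>R\<close>) colours such that distinct walls crossed by a path of length \<open>R\<close> get different colours. The label
  at level \<open>k\<close> contains the colour of the \<open>k\<close>-th wall at a fixed scale, which makes the folding isometric on
  balls. For the lower bound, let \<open>P\<close> be a large constant. In each block of \<open>2\<^sup>v\<^sup>+\<^sup>1 P\<close> levels the colour of the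
  first wall of the block at a scale \<open>R\<close> proportional to \<open>2\<^sup>v P\<close> is cut into \<open>P\<close> digits, and these are
  written into \<open>P\<close> labels of the second half of the block, where there is room for them. Two lists that part
  and nevertheless keep equal labels for two blocks would thus contain distinct walls of equal colour, so the folding
  loses at most a number of levels proportional to, and much smaller than, the distance in the group.
\<close>

section \<open>Distances and codes in trees\<close>

definition simple_path :: "('v \<Rightarrow> 'v \<Rightarrow> bool) \<Rightarrow> 'v \<Rightarrow> 'v list \<Rightarrow> 'v \<Rightarrow> bool"
  where "simple_path E x p y \<longleftrightarrow> p \<noteq> [] \<and> hd p = x \<and> last p = y \<and> distinct p \<and> successively E p"

lemma simple_path_Cons:
  assumes "simple_path E y p z" "E x y" "x \<notin> set p"
  shows "simple_path E x (x # p) z"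
  using assms by (auto simp: simple_path_def successively_Cons)

lemma simple_path_suffix:
  assumes "simple_path E x (p @ y # q) z"
  shows "simple_path E y (y # q) z"
  using assms by (auto simp: simple_path_def successively_append_iff)

text \<open>Loop erasure: when the next vertex already lies on the path, the path is cut off
  there.\<close>

lemma simple_path_of_relpowp:
  assumes "(E ^^ k) x y"
  shows "\<exists>p. simple_path E x p y \<and> length p \<le> Suc k"
  using assms
proof (induction k arbitrary: y)
  case 0
  then show ?case by (intro exI[of _ "[x]"]) (auto simp: simple_path_def)
next
  case (Suc k)
  then obtain z where z: "(E ^^ k) x z" "E z y" by auto
  then obtain p where p: "simple_path E x p z" "length p \<le> Suc k" using Suc.IH by blast
  show ?case
  proof (cases "y \<in> set p")
    case True
    then obtain a b where "p = a @ y # b" by (meson split_list)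
    with p show ?thesis
      by (intro exI[of _ "a @ [y]"]) (auto simp: simple_path_def successively_append_iff hd_append)
  next
    case False
    with p z show ?thesis
      by (intro exI[of _ "p @ [y]"]) (auto simp: simple_path_def successively_append_iff)
  qed
qed

lemma relpowp_of_successively:
  "successively E (x # p) \<Longrightarrow> (E ^^ length p) x (last (x # p))"
proof (induction p arbitrary: x)
  case (Cons y p)
  then show ?case using relpowp_Suc_I2[of E x y "length p"] by (auto simp: successively_Cons)
qed auto

text \<open>If both paths take the same first step, induction applies to the tails. Otherwise the
  path \<open>p\<close>, followed up to its first return to \<open>q\<close>, closes up with the
  corresponding part of \<open>q\<close> to a cycle.\<close>

lemma simple_path_unique:
  assumes sym: "\<And>x y. E x y \<Longrightarrow> E y x" and acyclic: "\<nexists>p. graph_cycle E p"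
  assumes "simple_path E x p y" "simple_path E x q y"
  shows "p = q"
  using assms(3,4)
proof (induction p arbitrary: x q)
  case Nil
  then show ?case by (simp add: simple_path_def)
next
  case (Cons x' p)
  have [simp]: "x' = x" using Cons.prems by (simp add: simple_path_def)
  obtain q' where q: "q = x # q'" using Cons.prems(2) by (cases q) (auto simp: simple_path_def)
  show ?case
  proof (cases "p = []")
    case True
    then have "x = y" using Cons.prems by (auto simp: simple_path_def)
    then show ?thesis using Cons.prems(2) True q by (auto simp: simple_path_def split: if_splits)
  next
    case False
    then have xy: "x \<noteq> y" "y \<in> set p" using Cons.prems(1) by (auto simp: simple_path_def)
    then have q': "q' \<noteq> []" "y \<in> set q'" using Cons.prems(2) q
      by (auto simp: simple_path_def split: if_splits)
    show ?thesis
    proof (cases "hd p = hd q'")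
      case True
      have "simple_path E (hd p) p y" "simple_path E (hd p) q' y"
        using Cons.prems False q q' True by (auto simp: simple_path_def successively_Cons split: if_splits)
      then show ?thesis using Cons.IH q by simp
    next
      case hd: False
      obtain p1 z p2 where p: "p = p1 @ z # p2" "z \<in> set q'" "\<forall>u\<in>set p1. u \<notin> set q'"
        using split_list_first_prop[of p "\<lambda>u. u \<in> set q'"] xy q' by blast
      obtain q1 q2 where q1: "q' = q1 @ z # q2" using p(2) by (meson split_list)
      let ?c = "x # p1 @ z # rev q1"
      have dist: "distinct ?c"
        using Cons.prems q q1 p by (auto simp: simple_path_def)
      \<comment> \<open>As the first steps differ, \<open>p1\<close> and \<open>q1\<close> are not
        both empty; this gives the cycle its three vertices.\<close>
      have ne: "p1 \<noteq> [] \<or> q1 \<noteq> []" using hd p q1 by auto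
      have S1: "successively E (x # p1 @ [z])"
        using Cons.prems(1) p by (auto simp: simple_path_def successively_append_iff successively_Cons hd_append)
      have S2: "successively E (x # q1 @ [z])"
        using Cons.prems(2) q q1 by (auto simp: simple_path_def successively_append_iff successively_Cons hd_append)
      have "successively (\<lambda>x y. E y x) (q1 @ [z])"
        by (rule successively_mono[where P = E])
          (use S2 sym in \<open>auto simp: successively_Cons split: if_splits\<close>)
      then have "successively E (rev (q1 @ [z]))"
        unfolding successively_rev .
      then have S3: "successively E (z # rev q1)" by simp
      have "successively E ?c"
        using S1 S3 by (auto simp: successively_append_iff successively_Cons hd_append)
      moreover have "E x (last ?c)"
        using S2 by (cases q1) (auto simp: successively_Cons hd_append)
      then have "E (last ?c) x" by (rule sym)
      moreover have "3 \<le> length ?c" using ne by (cases p1; cases q1) auto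
      ultimately have "graph_cycle E ?c" using dist by (auto simp: graph_cycle_def)
      then show ?thesis using acyclic by blast
    qed
  qed
qed

section \<open>Depth, parents and children with respect to a base vertex\<close>

locale tree =
  fixes V :: "'v set" and E :: "'v \<Rightarrow> 'v \<Rightarrow> bool"
  assumes tree: "simplicial_tree V E"
begin

lemma adj_sym: "E x y \<Longrightarrow> E y x" and adj_ne: "E x y \<Longrightarrow> x \<noteq> y" and adj_in: "E x y \<Longrightarrow> x \<in> V" "E x y \<Longrightarrow> y \<in> V"
  using tree unfolding simplicial_tree_def simple_graph_def by blast+

lemma path_unique: "simple_path E x p y \<Longrightarrow> simple_path E x q y \<Longrightarrow> p = q"
  using simple_path_unique[of E x p y q] tree unfolding simplicial_tree_def simple_graph_def by blast

lemma path_exists: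
  assumes "x \<in> V" "y \<in> V"
  obtains p where "simple_path E x p y"
  using assms tree simple_path_of_relpowp[of _ E x y] rtranclp_power[of E x y]
  by (metis simplicial_tree_def)

definition depth :: "'v \<Rightarrow> 'v \<Rightarrow> nat" where "depth x y = (LEAST k. (E ^^ k) x y)"

lemma graph_dist_depth: "graph_dist E x y = real (depth x y)"
  by (simp add: graph_dist_def depth_def)

lemma depth_path:
  assumes "simple_path E x p y"
  shows "depth x y = length p - 1"
  unfolding depth_def
proof (rule Least_equality)
  show "(E ^^ (length p - 1)) x y"
    using relpowp_of_successively[of E x "tl p"] assms
    by (cases p) (auto simp: simple_path_def)
  show "length p - 1 \<le> k" if "(E ^^ k) x y" for k
    using simple_path_of_relpowp[OF that] path_unique[OF assms] by force
qed

text \<open>The path from \<open>t\<close> to \<open>b\<close> either avoids \<open>u\<close>, and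
  then \<open>u\<close> can be put in front of it, or passes through \<open>u\<close>, necessarily
  as its second vertex. The second case keeps the path itself, so that uniqueness of paths makes the
  parent unique.\<close>

lemma neighbour_depth:
  assumes "E t u" "b \<in> V"
  shows "depth u b = Suc (depth t b) \<or> (\<exists>p. simple_path E t (t # u # p) b \<and> depth t b = Suc (depth u b))"
proof -
  obtain p where p: "simple_path E t p b" using path_exists assms adj_in by metis
  show ?thesis
  proof (cases "u \<in> set p")
    case False
    then have "simple_path E u (u # p) b" using simple_path_Cons[OF p] assms adj_sym by blast
    from depth_path[OF this] depth_path[OF p] show ?thesis
      using p by (simp add: simple_path_def)
  next
    case True
    then obtain p1 p2 where p12: "p = p1 @ u # p2" by (meson split_list)
    have u: "simple_path E u (u # p2) b" using p p12 simple_path_suffix by metis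
    moreover have "t \<notin> set (u # p2)"
      using p p12 adj_ne[OF assms(1)] by (cases p1) (auto simp: simple_path_def)
    ultimately have t: "simple_path E t (t # u # p2) b" using simple_path_Cons assms(1) by metis
    then show ?thesis using depth_path[OF u] depth_path[OF t] by auto
  qed
qed

lemma parent_unique:
  assumes "E t u" "E t u'" "b \<in> V" "depth u b \<noteq> Suc (depth t b)" "depth u' b \<noteq> Suc (depth t b)"
  shows "u = u'"
  using neighbour_depth[OF assms(1,3)] neighbour_depth[OF assms(2,3)] path_unique assms(4,5) by blast

definition children :: "'v \<Rightarrow> 'v \<Rightarrow> 'v set"
  where "children b t = {u. E t u \<and> depth u b = Suc (depth t b)}"

text \<open>All neighbours except possibly the parent are children.\<close>

lemma children_card:
  assumes "b \<in> V" "finite (children b t)"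
  shows "finite {u. E t u} \<and> card {u. E t u} \<le> Suc (card (children b t))"
proof -
  obtain a where "{u. E t u} \<subseteq> insert a (children b t)"
  proof (cases "{u. E t u} \<subseteq> children b t")
    case False
    then obtain a where "E t a" "a \<notin> children b t" by auto
    then have "{u. E t u} \<subseteq> insert a (children b t)"
      using parent_unique[of t a _ b] assms(1) unfolding children_def by blast
    then show ?thesis using that by blast
  qed (use that in blast)
  moreover have "card (insert a (children b t)) \<le> Suc (card (children b t))" for a
    using assms by (simp add: card_insert_if)
  ultimately show ?thesis
    using assms by (meson card_mono finite_insert finite_subset le_trans)
qed

end

section \<open>Coding words over growing alphabets by vertices of the tree\<close>

lemma finite_real_below: "finite {j. real j < x}"
  by (rule finite_subset[of _ "{..<nat \<lceil>x\<rceil>}"]) (auto simp: less_ceiling_iff zless_nat_eq_int_zless)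

lemma card_real_below: "{j. real j < x} = {..<nat \<lceil>x\<rceil>}"
  by (auto simp: less_ceiling_iff zless_nat_eq_int_zless)

text \<open>The words whose \<open>k\<close>-th letter is below
  \<open>K * exp (\<sigma> * k)\<close> form a rooted tree under the prefix order, and it embeds
  isometrically into the given one; \<open>m\<close> is the length of the common prefix. The rate
  \<open>\<sigma>\<close> belongs to the tree, whereas any factor \<open>K\<close> can be had by
  placing the root deep enough.\<close>

theorem (in tree) tree_coding:
  assumes "exponentially_branching V E"
  obtains \<sigma> :: real where "\<sigma> > 0" "\<And>K::real. \<exists>F :: nat list \<Rightarrow> 'v. \<forall>A B.
    (\<forall>k<length A. real (A ! k) < K * exp (\<sigma> * real k)) \<longrightarrow> (\<forall>k<length B. real (B ! k) < K * exp (\<sigma> * real k)) \<longrightarrow>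
    F A \<in> V \<and> (\<exists>m. m \<le> length A \<and> m \<le> length B \<and> (\<forall>k<m. A ! k = B ! k) \<and>
      (m < length A \<and> m < length B \<longrightarrow> A ! m \<noteq> B ! m) \<and>
      graph_dist E (F A) (F B) = real (length A - m) + real (length B - m))"
proof -
  obtain b \<sigma> where b: "b \<in> V" and \<sigma>: "\<sigma> > 0" and
    br: "\<And>t. t \<in> V \<Longrightarrow> infinite {u. E t u} \<or> real (card {u. E t u}) > exp (\<sigma> * real (depth t b))"
    using assms by (auto simp: exponentially_branching_def exponentially_branching_at_def graph_dist_depth)
  have ch: "infinite (children b t) \<or> exp (\<sigma> * real (depth t b)) < card (children b t) + 1" if "t \<in> V" for t
    using br[OF that] children_card[OF b, of t] by force
  have deep: "\<exists>t\<in>V. depth t b = D" for D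
  proof (induction D)
    case 0
    have "simple_path E b [b] b" by (auto simp: simple_path_def)
    then show ?case using b depth_path by force
  next
    case (Suc D)
    then obtain t where t: "t \<in> V" "depth t b = D" by blast
    have "exp (\<sigma> * real (depth t b)) \<ge> 1" using \<sigma> by simp
    then have "children b t \<noteq> {}" using ch[OF t(1)] by force
    then show ?case using t adj_in by (auto simp: children_def)
  qed
  show ?thesis
  proof (rule that[OF \<sigma>])
    fix K :: real
    \<comment> \<open>The vertex for the empty word lies at depth \<open>D\<close>. The extra 1 in
      \<open>K + 1\<close> pays for the neighbour that may be the parent.\<close>
    obtain D :: nat where D: "exp (\<sigma> * D) \<ge> K + 1"
    proof -
      obtain D :: nat where "real D > ln (\<bar>K\<bar> + 1) / \<sigma>" using reals_Archimedean2 by blast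
      then have "ln (\<bar>K\<bar> + 1) < \<sigma> * D" using \<sigma> by (simp add: field_simps)
      then have "exp (ln (\<bar>K\<bar> + 1)) < exp (\<sigma> * D)" by (subst exp_less_cancel_iff)
      then have "\<bar>K\<bar> + 1 < exp (\<sigma> * D)" by (subst (asm) exp_ln) auto
      then show ?thesis using that[of D] by linarith
    qed
    obtain t1 where t1: "t1 \<in> V" "depth t1 b = D" using deep by blast
    define J where "J t = {j. real j < K * exp (\<sigma> * real (depth t b - D))}" for t
    have "\<exists>f. inj_on f (J t) \<and> f ` J t \<subseteq> children b t" if t: "t \<in> V" "depth t b \<ge> D" for t
    proof -
      have fin: "finite (J t)" unfolding J_def by (rule finite_real_below)
      show ?thesis
      proof (cases "finite (children b t)")
        case True
        let ?x = "K * exp (\<sigma> * real (depth t b - D))"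
        have "?x + 1 \<le> (K + 1) * exp (\<sigma> * real (depth t b - D))"
          using \<sigma> by (simp add: distrib_right)
        also have "\<dots> \<le> exp (\<sigma> * D) * exp (\<sigma> * real (depth t b - D))"
          by (rule mult_right_mono[OF D]) auto
        also have "\<dots> = exp (\<sigma> * real (depth t b))"
          using t by (simp flip: exp_add add: algebra_simps of_nat_diff)
        also have "\<dots> < card (children b t) + 1" using ch[OF t(1)] True by simp
        finally have "?x \<le> card (children b t)" by simp
        then have "card (J t) \<le> card (children b t)"
          unfolding J_def card_real_below by (simp add: ceiling_le_iff)
        then show ?thesis using card_le_inj[OF fin True] by blast
      next
        case False
        then obtain C where C: "C \<subseteq> children b t" "finite C" "card C = card (J t)"
          using infinite_arbitrarily_large by blast
        then show ?thesis using card_le_inj[OF fin C(2)] by force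
      qed
    qed
    then obtain f where f: "\<And>t. t \<in> V \<Longrightarrow> depth t b \<ge> D \<Longrightarrow> inj_on (f t) (J t) \<and> f t ` J t \<subseteq> children b t"
      by metis
    define F where "F A = foldl f t1 A" for A
    define val where "val A \<longleftrightarrow> (\<forall>k<length A. real (A ! k) < K * exp (\<sigma> * k))" for A :: "nat list"
    have val_take: "val (take k A)" if "val A" for k A using that by (auto simp: val_def)
    have val_snoc: "val (A @ [j]) \<longleftrightarrow> val A \<and> real j < K * exp (\<sigma> * length A)" for A j
      by (auto simp: val_def nth_append less_Suc_eq)
    have F_snoc: "F (A @ [j]) = f (F A) j" for A j by (simp add: F_def)
    have F: "F A \<in> V \<and> depth (F A) b = D + length A" if "val A" for A
      using that
    proof (induction A rule: rev_induct)
      case Nil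
      then show ?case using t1 by (simp add: F_def)
    next
      case (snoc j A)
      then have A: "F A \<in> V" "depth (F A) b = D + length A" "j \<in> J (F A)"
        by (auto simp: val_snoc J_def)
      then have "f (F A) j \<in> children b (F A)" using f[of "F A"] by auto
      then show ?case using A adj_in by (auto simp: children_def F_snoc)
    qed
    have F_child: "f (F A) j \<in> children b (F A)" if "val (A @ [j])" for A j
    proof -
      have "val A" and j: "real j < K * exp (\<sigma> * length A)" using that by (auto simp: val_snoc)
      then have A: "F A \<in> V" "depth (F A) b = D + length A" using F by auto
      then have "j \<in> J (F A)" using j by (simp add: J_def)
      then show ?thesis using f[of "F A"] A by auto
    qed
    have F_inj: "A = B" if "val A" "val B" "F A = F B" for A B
      using that
    proof (induction A arbitrary: B rule: rev_induct)
      case Nil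
      have "depth (F []) b = D" "depth (F B) b = D + length B"
        using F[OF Nil(1)] F[OF Nil(2)] by simp_all
      then have "length B = 0" unfolding Nil(3) by linarith
      then show ?case by simp
    next
      case (snoc j A)
      have "length B = Suc (length A)" using F[of "A @ [j]"] F[of B] snoc.prems by simp
      then obtain B' j' where B: "B = B' @ [j']" by (metis append_butlast_last_id length_0_conv nat.distinct(1))
      have vA: "val A" "val B'" using snoc.prems B by (auto simp: val_snoc)
      have len: "length A = length B'" using \<open>length B = Suc (length A)\<close> B by simp
      let ?u = "F (A @ [j])"
      have u: "?u \<in> children b (F A)" "?u \<in> children b (F B')"
        using F_child[of A j] F_child[of B' j'] snoc.prems B by (auto simp flip: F_snoc)
      then have "E ?u (F A)" "E ?u (F B')" by (auto simp: children_def adj_sym)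
      with u have "F A = F B'"
        using parent_unique[of ?u "F A" "F B'" b] b by (auto simp: children_def)
      then have AB: "A = B'" using snoc.IH vA by blast
      moreover have "f (F A) j = f (F A) j'" using snoc.prems(3) B AB by (simp add: F_snoc)
      then have "j = j'"
        using f[of "F A"] F[OF vA(1)] snoc.prems(1,2) B AB by (auto simp: inj_on_def val_snoc J_def)
      ultimately show ?case using B by simp
    qed
    have dist: "\<exists>m. m \<le> length A \<and> m \<le> length B \<and> (\<forall>k<m. A ! k = B ! k) \<and>
      (m < length A \<and> m < length B \<longrightarrow> A ! m \<noteq> B ! m) \<and>
      graph_dist E (F A) (F B) = real (length A - m) + real (length B - m)" if v: "val A" "val B" for A B
    proof -
      \<comment> \<open>The longest common prefix. The path from \<open>F A\<close> to
        \<open>F B\<close> climbs along \<open>?p\<close> to the vertex of this prefix and descends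
        along \<open>?q\<close>, which begins at \<open>Suc m\<close> so that the turning point is
        listed once.\<close>
      define m where "m = (GREATEST m. m \<le> length A \<and> m \<le> length B \<and> take m A = take m B)"
      let ?P = "\<lambda>m. m \<le> length A \<and> m \<le> length B \<and> take m A = take m B"
      have m: "?P m" unfolding m_def by (rule GreatestI_nat[of ?P 0 "length A"]) auto
      have m_max: "k \<le> m" if "?P k" for k
        unfolding m_def by (rule Greatest_le_nat[of ?P k "length A"]) (use that in auto)
      have eq: "A ! k = B ! k" if "k < m" for k using m that by (metis nth_take)
      have ne: "A ! m \<noteq> B ! m" if "m < length A" "m < length B"
        using m_max[of "Suc m"] that m by (auto simp: take_Suc_conv_app_nth)
      let ?p = "map (\<lambda>k. F (take k A)) (rev [m..<Suc (length A)])"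
      let ?q = "map (\<lambda>k. F (take k B)) [Suc m..<Suc (length B)]"
      have lev: "depth (F (take k A)) b = D + k" if "k \<le> length A" for k
        using F[OF val_take[OF v(1)], of k] that by simp
      have lev': "depth (F (take k B)) b = D + k" if "k \<le> length B" for k
        using F[OF val_take[OF v(2)], of k] that by simp
      have edge: "E (F (take k X)) (F (take (Suc k) X))" if "val X" "k < length X" for k X
        using F_child[of "take k X" "X ! k"] that val_take[OF that(1), of "Suc k"]
        by (auto simp: take_Suc_conv_app_nth F_snoc children_def)
      have upt: "successively (\<lambda>x y. y = Suc x) [i..<j]" for i j
        by (induction j) (auto simp: successively_append_iff le_less)
      have "distinct (?p @ ?q)"
      proof -
        have "inj_on (\<lambda>k. F (take k A)) {m..<Suc (length A)}"
          by (rule inj_on_imageI2[of "\<lambda>t. depth t b"], rule inj_onI) (use lev in auto)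
        moreover have "inj_on (\<lambda>k. F (take k B)) {Suc m..<Suc (length B)}"
          by (rule inj_on_imageI2[of "\<lambda>t. depth t b"], rule inj_onI) (use lev' in auto)
        \<comment> \<open>Equal vertices have equal depth, hence \<open>k = l\<close>, and by
          injectivity the prefixes would agree beyond \<open>m\<close>.\<close>
        moreover have cross: "F (take k A) \<noteq> F (take l B)" if "m \<le> k" "k \<le> length A" "Suc m \<le> l" "l \<le> length B" for k l
        proof
          assume *: "F (take k A) = F (take l B)"
          then have "k = l" using lev[of k] lev'[of l] that by simp
          moreover have "take k A = take l B" using F_inj[OF _ _ *] v val_take by blast
          ultimately show False using m_max[of k] that by auto
        qed
        have "set ?p \<inter> set ?q = {}"
          using cross by (auto simp: less_Suc_eq_le simp del: upt_Suc)
        with calculation show ?thesis by (simp add: distinct_map del: upt_Suc)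
      qed
      moreover have "successively E ?p"
        unfolding successively_map successively_rev
        by (rule successively_mono[OF upt]) (use adj_sym[OF edge[OF v(1)]] in auto)
      moreover have "successively E ?q"
        unfolding successively_map
        by (rule successively_mono[OF upt]) (use edge[OF v(2)] in auto)
      moreover have "E (last ?p) (hd ?q)" if "?q \<noteq> []"
        using that m edge[OF v(2), of m] by (auto simp: last_map last_rev hd_map simp del: upt_Suc)
      moreover have "hd (?p @ ?q) = F A" using m by (auto simp: hd_map hd_rev)
      moreover have "last (?p @ ?q) = F B"
        using m by (cases "m = length B") (auto simp: last_map last_rev simp del: upt_Suc)
      ultimately have "simple_path E (F A) (?p @ ?q) (F B)"
        using m by (auto simp: simple_path_def successively_append_iff simp del: upt_Suc)
      then have "graph_dist E (F A) (F B) = real (length A - m) + real (length B - m)"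
        using m unfolding graph_dist_depth by (auto dest!: depth_path simp del: upt_Suc)
      then show ?thesis using m eq ne by (intro exI[of _ m]) auto
    qed
    show "\<exists>F :: nat list \<Rightarrow> 'v. \<forall>A B.
      (\<forall>k<length A. real (A ! k) < K * exp (\<sigma> * real k)) \<longrightarrow> (\<forall>k<length B. real (B ! k) < K * exp (\<sigma> * real k)) \<longrightarrow>
      F A \<in> V \<and> (\<exists>m. m \<le> length A \<and> m \<le> length B \<and> (\<forall>k<m. A ! k = B ! k) \<and>
        (m < length A \<and> m < length B \<longrightarrow> A ! m \<noteq> B ! m) \<and>
        graph_dist E (F A) (F B) = real (length A - m) + real (length B - m))"
      using F dist unfolding val_def by blast
  qed
qed

section \<open>Words in a right-angled Coxeter group\<close>

locale racg = group G for G :: "('g, 'm) monoid_scheme" (structure) +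
  fixes S :: "'g set"
  assumes racg: "right_angled_coxeter_group G S"
begin

declare in_lists_conv_set [simp] ball_Un [simp]

abbreviation wv :: "'g list \<Rightarrow> 'g" where "wv \<equiv> word_value G"

lemma finite_S: "finite S" and S_carrier: "s \<in> S \<Longrightarrow> s \<in> carrier G"
  using racg by (auto simp: right_angled_coxeter_group_def)

lemma S_sq: "s \<in> S \<Longrightarrow> s \<otimes> s = \<one>"
  using racg pow_ord_eq_1[of s] by (auto simp: right_angled_coxeter_group_def numeral_2_eq_2)

lemma inv_S: "s \<in> S \<Longrightarrow> inv s = s"
  using S_sq S_carrier inv_equality by blast

lemma wv_Nil [simp]: "wv [] = \<one>" and wv_Cons [simp]: "wv (s # w) = s \<otimes> wv w"
  by (simp_all add: word_value_def)

lemma wv_closed [simp]: "w \<in> lists S \<Longrightarrow> wv w \<in> carrier G"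
  by (induction w) (auto simp: S_carrier)

lemma wv_append: "u \<in> lists S \<Longrightarrow> v \<in> lists S \<Longrightarrow> wv (u @ v) = wv u \<otimes> wv v"
  by (induction u) (auto simp: S_carrier m_assoc)

lemma wv_rev: "w \<in> lists S \<Longrightarrow> wv (rev w) = inv (wv w)"
  by (induction w) (auto simp: wv_append S_carrier inv_mult_group inv_S)

lemma wv_surj:
  assumes "x \<in> carrier G"
  obtains w where "w \<in> lists S" "wv w = x"
proof -
  have "x \<in> generate G S" using assms racg by (simp add: right_angled_coxeter_group_def)
  then have "\<exists>w\<in>lists S. wv w = x"
  proof induction
    case one
    then show ?case by (intro bexI[of _ "[]"]) auto
  next
    case (incl h)
    then show ?case by (intro bexI[of _ "[h]"]) (auto simp: S_carrier)
  next
    case (inv h)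
    then show ?case by (intro bexI[of _ "[h]"]) (auto simp: S_carrier inv_S)
  next
    case (eng h1 h2)
    then obtain u v where "u \<in> lists S" "v \<in> lists S" "wv u = h1" "wv v = h2" by blast
    then show ?case by (intro bexI[of _ "u @ v"]) (auto simp: wv_append)
  qed
  then show ?thesis using that by blast
qed

text \<open>A function on words that is unchanged by both elementary moves depends only on the group
  element. The contexts in \<open>coxeter_consequence\<close> range over all words, so the induction
  also carries membership in \<open>lists S\<close>.\<close>

lemma word_invariant:
  assumes "u \<in> lists S" "v \<in> lists S" "wv u = wv v"
    and sq: "\<And>a b s. a \<in> lists S \<Longrightarrow> b \<in> lists S \<Longrightarrow> s \<in> S \<Longrightarrow> h (a @ [s, s] @ b) = h (a @ b)"
    and comm: "\<And>a b s t. a \<in> lists S \<Longrightarrow> b \<in> lists S \<Longrightarrow> s \<in> S \<Longrightarrow> t \<in> S \<Longrightarrow> s \<noteq> t \<Longrightarrow> s \<otimes> t = t \<otimes> s \<Longrightarrow>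
      h (a @ [s, t] @ b) = h (a @ [t, s] @ b)"
  shows "h u = h v"
proof -
  have "coxeter_consequence G S u v"
    using assms(1-3) racg by (auto simp: right_angled_coxeter_group_def)
  then have "(u \<in> lists S \<longleftrightarrow> v \<in> lists S) \<and> (u \<in> lists S \<longrightarrow> h u = h v)"
  proof induction
    case (square s u v)
    then show ?case using sq by auto
  next
    case (commute s t u v)
    then show ?case using comm by (cases "s = t") auto
  qed auto
  then show ?thesis using assms by blast
qed

section \<open>Reduced words and the word metric\<close>

definition reduced :: "'g list \<Rightarrow> bool"
  where "reduced w \<longleftrightarrow> w \<in> lists S \<and> (\<forall>v\<in>lists S. wv v = wv w \<longrightarrow> length w \<le> length v)"

lemma reduced_exists:
  assumes "x \<in> carrier G"
  obtains w where "reduced w" "wv w = x"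
proof -
  obtain w0 where w0: "w0 \<in> lists S \<and> wv w0 = x" using wv_surj[OF assms] by blast
  define w where "w = (ARG_MIN length w. w \<in> lists S \<and> wv w = x)"
  have "w \<in> lists S \<and> wv w = x"
    unfolding w_def using w0 by (rule arg_min_natI)
  moreover have "length w \<le> length v" if "v \<in> lists S \<and> wv v = x" for v
    unfolding w_def using that by (rule arg_min_nat_le)
  ultimately have "reduced w" "wv w = x" unfolding reduced_def by blast+
  then show ?thesis by (rule that)
qed

lemma reduced_append1:
  assumes "reduced (u @ v)"
  shows "reduced u"
proof -
  have uv: "u \<in> lists S" "v \<in> lists S" using assms by (auto simp: reduced_def)
  have "length u \<le> length w" if "w \<in> lists S" "wv w = wv u" for w
  proof -
    have "wv (w @ v) = wv (u @ v)" using that uv by (simp only: wv_append)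
    moreover have "w @ v \<in> lists S" using that uv by simp
    ultimately have "length (u @ v) \<le> length (w @ v)" using assms unfolding reduced_def by blast
    then show ?thesis by simp
  qed
  then show ?thesis using uv by (auto simp: reduced_def)
qed

lemma cayley_relpowp:
  "x \<in> carrier G \<Longrightarrow> (cayley_adj G S ^^ k) x y \<longleftrightarrow> (\<exists>w\<in>lists S. length w = k \<and> y = x \<otimes> wv w)"
proof (induction k arbitrary: y)
  case 0
  then show ?case by auto
next
  case (Suc k)
  have "(cayley_adj G S ^^ Suc k) x y \<longleftrightarrow>
      (\<exists>w\<in>lists S. length w = k \<and> (\<exists>s\<in>S. y = x \<otimes> wv w \<otimes> s))"
    using Suc.prems unfolding relpowp.simps relcompp_apply Suc.IH[OF Suc.prems] cayley_adj_def
    by auto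
  also have "\<dots> \<longleftrightarrow> (\<exists>w\<in>lists S. length w = Suc k \<and> y = x \<otimes> wv w)" (is "?L \<longleftrightarrow> ?R")
  proof
    assume ?L
    then obtain w s where "w \<in> lists S" "length w = k" "s \<in> S" "y = x \<otimes> wv w \<otimes> s" by blast
    then show ?R using Suc.prems
      by (intro bexI[of _ "w @ [s]"]) (auto simp: wv_append S_carrier m_assoc)
  next
    assume ?R
    then obtain w where w: "w \<in> lists S" "length w = Suc k" "y = x \<otimes> wv w" by blast
    then obtain v s where "w = v @ [s]" by (metis length_0_conv nat.distinct(1) rev_exhaust)
    then show ?L using w Suc.prems
      by (intro bexI[of _ v]) (auto simp: wv_append S_carrier m_assoc)
  qed
  finally show ?case .
qed

lemma graph_dist_reduced:
  assumes "x \<in> carrier G" "reduced w"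
  shows "graph_dist (cayley_adj G S) x (x \<otimes> wv w) = length w"
proof -
  have w: "w \<in> lists S" using assms by (simp add: reduced_def)
  have "(LEAST k. (cayley_adj G S ^^ k) x (x \<otimes> wv w)) = length w"
  proof (rule Least_equality)
    show "(cayley_adj G S ^^ length w) x (x \<otimes> wv w)"
      using cayley_relpowp assms w by blast
    fix k assume "(cayley_adj G S ^^ k) x (x \<otimes> wv w)"
    then obtain v where "v \<in> lists S" "length v = k" "x \<otimes> wv w = x \<otimes> wv v"
      using cayley_relpowp[OF assms(1), of k] by blast
    then show "length w \<le> k" using assms w by (auto simp: reduced_def)
  qed
  then show ?thesis by (simp add: graph_dist_def)
qed

lemma geodesic_word:
  assumes "x \<in> carrier G" "y \<in> carrier G"
  obtains w where "reduced w" "y = x \<otimes> wv w" "graph_dist (cayley_adj G S) x y = length w"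
proof -
  obtain w where w: "reduced w" "wv w = inv x \<otimes> y" using reduced_exists[of "inv x \<otimes> y"] assms by auto
  then have "y = x \<otimes> wv w" using assms by (simp flip: m_assoc)
  with graph_dist_reduced[OF assms(1) w(1)] that[OF w(1)] show ?thesis by simp
qed

lemma graph_dist_le:
  assumes "x \<in> carrier G" "w \<in> lists S"
  shows "graph_dist (cayley_adj G S) x (x \<otimes> wv w) \<le> length w"
  unfolding graph_dist_def using cayley_relpowp[OF assms(1)] assms(2)
  by (auto intro!: Least_le)

lemma Metric_space_cayley: "Metric_space (carrier G) (graph_dist (cayley_adj G S))"
proof -
  let ?d = "graph_dist (cayley_adj G S)"
  have sym: "?d y x \<le> ?d x y" if xy: "x \<in> carrier G" "y \<in> carrier G" for x y
  proof -
    obtain w where w: "reduced w" "y = x \<otimes> wv w" "?d x y = length w" using geodesic_word xy by blast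
    then have "x = y \<otimes> wv (rev w)" "rev w \<in> lists S"
      using xy by (auto simp: reduced_def wv_rev m_assoc)
    then show ?thesis using graph_dist_le[of y "rev w"] w xy by simp
  qed
  show ?thesis
  proof
    show "0 \<le> ?d x y" for x y by (simp add: graph_dist_def)
    show "?d x y = ?d y x" for x y
    proof (cases "(x \<in> carrier G \<and> y \<in> carrier G) \<or> x = y")
      case True
      then show ?thesis using sym by (auto intro: antisym)
    next
      case False
      \<comment> \<open>\<open>Metric_space\<close> demands symmetry for all pairs. Distinct points
        not both in the group are joined by no walk in either direction, so both distances are the
        \<open>LEAST\<close> of the same empty predicate.\<close>
      have "\<not> (cayley_adj G S ^^ k) x y" if "x \<noteq> y" "\<not> (x \<in> carrier G \<and> y \<in> carrier G)" for k x y
      proof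
        assume *: "(cayley_adj G S ^^ k) x y"
        then have "x \<in> carrier G"
          using that(1) by (cases k) (auto elim!: relpowp_Suc_E2 simp del: relpowp.simps(2) simp: cayley_adj_def)
        then show False using * cayley_relpowp[of x k y] that(2) by auto
      qed
      from this[of x y] this[of y x] False
      have "(\<lambda>k. (cayley_adj G S ^^ k) x y) = (\<lambda>k. (cayley_adj G S ^^ k) y x)" by blast
      then show ?thesis by (simp add: graph_dist_def)
    qed
    show "?d x y = 0 \<longleftrightarrow> x = y" if xy: "x \<in> carrier G" "y \<in> carrier G" for x y
    proof
      assume "?d x y = 0"
      moreover obtain w where "y = x \<otimes> wv w" "?d x y = length w" using geodesic_word xy by blast
      ultimately show "x = y" using xy by simp
    next
      assume "x = y"
      then show "?d x y = 0" using graph_dist_le[of x "[]"] xy by (simp add: graph_dist_def)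
    qed
    show "?d x z \<le> ?d x y + ?d y z" if xyz: "x \<in> carrier G" "y \<in> carrier G" "z \<in> carrier G" for x y z
    proof -
      obtain u where u: "reduced u" "y = x \<otimes> wv u" "?d x y = length u" using geodesic_word xyz by blast
      obtain v where v: "reduced v" "z = y \<otimes> wv v" "?d y z = length v" using geodesic_word xyz by blast
      have uv: "u \<in> lists S" "v \<in> lists S" using u v by (auto simp: reduced_def)
      then have "z = x \<otimes> wv (u @ v)" using u(2) v(2) xyz(1) by (simp only: wv_append m_assoc wv_closed)
      then show ?thesis using graph_dist_le[of x "u @ v"] uv u v xyz by simp
    qed
  qed
qed

text \<open>Equality of the two walls amounts to \<open>s v = v t\<close> in the group. Then both
  letters could be deleted without changing the element, against minimality of length.\<close>

lemma reduced_no_wall_twice: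
  assumes "reduced (u @ s # v @ t # z)"
  shows "wv u \<otimes> s \<otimes> inv (wv u) \<noteq> wv (u @ s # v) \<otimes> t \<otimes> inv (wv (u @ s # v))"
proof
  have S: "\<forall>x\<in>set u. x \<in> S" "\<forall>x\<in>set v. x \<in> S" "\<forall>x\<in>set z. x \<in> S" "s \<in> S" "t \<in> S"
    using assms by (auto simp: reduced_def)
  note [simp] = S S_carrier
  assume eq: "wv u \<otimes> s \<otimes> inv (wv u) = wv (u @ s # v) \<otimes> t \<otimes> inv (wv (u @ s # v))"
  let ?u = "wv u" and ?v = "wv v"
  have "wv (u @ s # v) \<otimes> t \<otimes> inv (wv (u @ s # v)) = ?u \<otimes> (s \<otimes> (?v \<otimes> t \<otimes> inv ?v \<otimes> s)) \<otimes> inv ?u"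
    by (simp add: wv_append inv_mult_group inv_S m_assoc)
  then have "?u \<otimes> s \<otimes> inv ?u = ?u \<otimes> (s \<otimes> (?v \<otimes> t \<otimes> inv ?v \<otimes> s)) \<otimes> inv ?u"
    using eq by simp
  then have "s = s \<otimes> (?v \<otimes> t \<otimes> inv ?v \<otimes> s)" by (simp add: right_cancel del: m_assoc)
  then have "?v \<otimes> t \<otimes> inv ?v \<otimes> s = \<one>" by (simp add: r_cancel_one')
  then have "inv s = ?v \<otimes> t \<otimes> inv ?v" by (intro inv_equality) auto
  then have "s = ?v \<otimes> t \<otimes> inv ?v" by (simp add: inv_S)
  then have "s \<otimes> ?v = ?v \<otimes> t" by (simp add: inv_solve_right)
  then have "s \<otimes> (?v \<otimes> t) = s \<otimes> (s \<otimes> ?v)" by simp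
  also have "\<dots> = ?v" by (simp add: S_sq flip: m_assoc)
  finally have "?v = s \<otimes> (?v \<otimes> t)" by (rule HOL.sym)
  then have "?v \<otimes> wv z = s \<otimes> (?v \<otimes> t) \<otimes> wv z" by simp
  then have "wv (u @ v @ z) = wv (u @ s # v @ t # z)"
    by (simp add: wv_append m_assoc)
  moreover have "u @ v @ z \<in> lists S" by simp
  ultimately have "length (u @ s # v @ t # z) \<le> length (u @ v @ z)"
    using assms unfolding reduced_def by blast
  then show False by simp
qed

subsection \<open>The integral reflection representation\<close>

text \<open>
  The dual representation: a functional is given by its values on the simple roots.
\<close>

definition act :: "'g \<Rightarrow> ('g \<Rightarrow> int) \<Rightarrow> 'g \<Rightarrow> int"
  where "act s f = (\<lambda>u. if u = s then - f s else if s \<otimes> u = u \<otimes> s then f u else f u + 2 * f s)"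

text \<open>The first letter acts first, so \<open>acts w f u\<close> is the value of
  \<open>f\<close> at the image of the simple root \<open>u\<close> under \<open>w\<close>.\<close>

definition acts :: "'g list \<Rightarrow> ('g \<Rightarrow> int) \<Rightarrow> 'g \<Rightarrow> int"
  where "acts w f = fold act w f"

lemma acts_simps [simp]: "acts [] f = f" "acts (s # w) f = acts w (act s f)"
    "acts (u @ v) f = acts v (acts u f)"
  by (simp_all add: acts_def)

lemma act_act [simp]: "act s (act s f) = f"
  by (auto simp: act_def)

lemma act_commute: "s \<otimes> t = t \<otimes> s \<Longrightarrow> act s (act t f) = act t (act s f)"
  by (auto simp: act_def fun_eq_iff)

lemma acts_cong:
  assumes "u \<in> lists S" "v \<in> lists S" "wv u = wv v"
  shows "acts u = acts v"
  by (rule word_invariant[OF assms]) (auto simp: fun_eq_iff act_commute)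

lemma acts_rev [simp]: "acts (rev w) (acts w f) = f" "acts w (acts (rev w) f) = f"
  by (induction w arbitrary: f) auto

lemma acts_bound: "(\<And>u. \<bar>f u\<bar> \<le> b) \<Longrightarrow> \<bar>acts w f u\<bar> \<le> 3 ^ length w * b"
proof (induction w arbitrary: f b)
  case (Cons s w)
  have "\<bar>act s f u\<bar> \<le> 3 * b" for u
    using Cons.prems[of u] Cons.prems[of s] by (auto simp: act_def)
  from Cons.IH[OF this] show ?case by (simp add: mult_ac)
qed auto

text \<open>The coefficients are the matrix entries of \<open>w\<close>; thus congruence of two
  actions needs to be checked on finitely many entries only.\<close>

lemma acts_linear:
  assumes "w \<in> lists S" "u \<in> S"
  shows "acts w f u = (\<Sum>s\<in>S. f s * acts w (\<lambda>t. if t = s then 1 else 0) u)"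
  using assms
proof (induction w arbitrary: u rule: rev_induct)
  case Nil
  then show ?case using finite_S by (simp add: if_distrib cong: if_cong)
next
  case (snoc t w)
  then show ?case
    by (auto simp: act_def sum_negf[symmetric] sum_distrib_left sum.distrib[symmetric] algebra_simps)
qed

lemma act_dvd:
  assumes "\<And>u. u \<in> S \<Longrightarrow> q dvd f u - g u" "s \<in> S" "u \<in> S"
  shows "q dvd act s f u - act s g u"
proof -
  have "act s f u - act s g u = act s (\<lambda>u. f u - g u) u" by (simp add: act_def)
  moreover have "q dvd act s h u" if "q dvd h s" "q dvd h u" for h
    using that by (simp add: act_def)
  ultimately show ?thesis using assms by presburger
qed

lemma acts_dvd:
  assumes "w \<in> lists S" "\<And>u. u \<in> S \<Longrightarrow> q dvd f u - g u" "u \<in> S"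
  shows "q dvd acts w f u - acts w g u"
  using assms
proof (induction w arbitrary: f g rule: list.induct)
  case (Cons s w)
  have sw: "s \<in> S" "w \<in> lists S" using Cons.prems(1) by auto
  have "q dvd acts w (act s f) u - acts w (act s g) u"
  proof (rule Cons.IH)
    show "q dvd act s f v - act s g v" if "v \<in> S" for v
      by (rule act_dvd[OF Cons.prems(2) sw(1) that])
  qed (use sw Cons.prems(3) in auto)
  then show ?case by simp
qed auto

text \<open>
  The third conjunct is what keeps the values nonzero when a letter is appended; by the fourth, a letter
  with negative value cannot be appended to a reduced word.
\<close>

lemma reduced_signs:
  assumes "reduced w"
  defines "f \<equiv> acts w (\<lambda>_. 1)"
  shows "(\<forall>s\<in>S. f s \<noteq> 0) \<and> (\<forall>s\<in>S. \<forall>t\<in>S. f s < 0 \<and> f t < 0 \<longrightarrow> s \<otimes> t = t \<otimes> s) \<and>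
    (\<forall>s\<in>S. \<forall>t\<in>S. f s > 0 \<and> f t < 0 \<and> s \<otimes> t \<noteq> t \<otimes> s \<longrightarrow> f s > - f t) \<and>
    (\<forall>s\<in>S. f s < 0 \<longrightarrow> (\<exists>u v. w = u @ s # v \<and> (\<forall>t\<in>set v. s \<otimes> t = t \<otimes> s))) \<and>
    (w \<noteq> [] \<longrightarrow> f (last w) < 0)"
  using assms(1) unfolding f_def
proof (induction w rule: rev_induct)
  case Nil
  then show ?case by simp
next
  case (snoc s w)
  let ?f = "acts w (\<lambda>_. 1)"
  let ?g = "acts (w @ [s]) (\<lambda>_. 1)"
  note IH = snoc.IH[OF reduced_append1[OF snoc.prems]]
  have ws: "w \<in> lists S" "s \<in> S" using snoc.prems by (auto simp: reduced_def)
  have nn: "?f t \<noteq> 0" if "t \<in> S" for t using IH that by blast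
  have cc: "s \<otimes> t = t \<otimes> s" if "s \<in> S" "t \<in> S" "?f s < 0" "?f t < 0" for s t using IH that by blast
  have dom: "?f s > - ?f t" if "s \<in> S" "t \<in> S" "?f s > 0" "?f t < 0" "s \<otimes> t \<noteq> t \<otimes> s" for s t
    using IH that by blast
  \<comment> \<open>A letter of negative value already occurs in \<open>w\<close> and commutes with
    everything after that occurrence, so appending it would cancel two letters.\<close>
  have "\<not> ?f s < 0"
  proof
    assume "?f s < 0"
    then obtain u v where uv: "w = u @ s # v" "\<forall>t\<in>set v. s \<otimes> t = t \<otimes> s" using IH ws by blast
    have uv_S: "u \<in> lists S" "v \<in> lists S" using uv ws by auto
    have "s \<otimes> wv v = wv v \<otimes> s"
      using uv(2) uv_S(2)
    proof (induction v)
      case (Cons t v)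
      then have t: "t \<in> S" "v \<in> lists S" "s \<otimes> t = t \<otimes> s" "s \<otimes> wv v = wv v \<otimes> s" by auto
      have "s \<otimes> (t \<otimes> wv v) = (s \<otimes> t) \<otimes> wv v" using t(1,2) ws by (simp add: S_carrier m_assoc)
      also have "\<dots> = t \<otimes> (s \<otimes> wv v)" using t(1,2) ws unfolding t(3) by (simp add: S_carrier m_assoc)
      also have "\<dots> = t \<otimes> wv v \<otimes> s" using t(1,2) ws unfolding t(4) by (simp add: S_carrier m_assoc)
      finally show ?case by simp
    qed (use ws S_carrier in simp)
    then have "wv (w @ [s]) = wv u \<otimes> (s \<otimes> (s \<otimes> wv v))"
      using uv uv_S ws by (simp add: wv_append S_carrier m_assoc)
    also have "\<dots> = wv (u @ v)" using uv_S ws by (simp add: wv_append S_carrier S_sq flip: m_assoc)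
    finally have "wv (u @ v) = wv (w @ [s])" by simp
    moreover have "u @ v \<in> lists S" using uv_S by simp
    ultimately have "length (w @ [s]) \<le> length (u @ v)"
      using snoc.prems unfolding reduced_def by blast
    then show False using uv by simp
  qed
  then have pos: "?f s > 0" using nn[OF ws(2)] by linarith
  \<comment> \<open>A negative value at \<open>t\<close> is outweighed by the value at
    \<open>s\<close>, by the third conjunct for \<open>w\<close>.\<close>
  have far: "?g t > ?f s \<and> ?g t > ?f t" if "t \<in> S" "s \<otimes> t \<noteq> t \<otimes> s" for t
  proof -
    have "?g t = ?f t + 2 * ?f s" using that by (auto simp: act_def)
    moreover have "?f t < 0 \<Longrightarrow> ?f s > - ?f t" using dom[of s t] that pos ws by simp
    ultimately show ?thesis using pos by linarith
  qed
  have near: "?g t = ?f t" if "t \<noteq> s" "s \<otimes> t = t \<otimes> s" for t using that by (simp add: act_def)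
  have gs: "?g s = - ?f s" by (simp add: act_def)
  \<comment> \<open>Appending \<open>s\<close> makes the value at \<open>s\<close> negative and
    keeps only those negative values whose letters commute with \<open>s\<close>.\<close>
  have neg: "t = s \<or> (t \<noteq> s \<and> s \<otimes> t = t \<otimes> s \<and> ?f t < 0 \<and> ?g t = ?f t)" if "t \<in> S" "?g t < 0" for t
    using far[of t] near[of t] that pos by (cases "t = s"; cases "s \<otimes> t = t \<otimes> s") auto
  show ?case
  proof (intro conjI ballI impI)
    show "?g t \<noteq> 0" if "t \<in> S" for t
      using far[of t] near[of t] gs that pos nn[of t] by (cases "t = s"; cases "s \<otimes> t = t \<otimes> s") auto
    show "t \<otimes> u = u \<otimes> t" if "t \<in> S" "u \<in> S" "?g t < 0 \<and> ?g u < 0" for t u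
      using neg[of t] neg[of u] cc[of t u] that by metis
    show "- ?g u < ?g t" if tu: "t \<in> S" "u \<in> S" "0 < ?g t \<and> ?g u < 0 \<and> t \<otimes> u \<noteq> u \<otimes> t" for t u
    proof -
      consider "u = s" | "s \<otimes> u = u \<otimes> s" "?f u < 0" "?g u = ?f u" using neg[of u] tu by blast
      then show ?thesis
      proof cases
        case 1
        then show ?thesis using far[of t] gs tu by auto
      next
        case 2
        have "t \<noteq> s" using 2 tu by auto
        have "?f t > 0 \<Longrightarrow> - ?f u < ?f t" using dom[of t u] tu 2 by blast
        moreover have "\<not> ?f t < 0" using cc[of t u] tu 2 by blast
        moreover have "?g t \<ge> ?f t"
          using near[OF \<open>t \<noteq> s\<close>] far[of t] tu by (cases "s \<otimes> t = t \<otimes> s") auto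
        ultimately show ?thesis using 2 nn[of t] tu by linarith
      qed
    qed
    show "\<exists>u v. w @ [s] = u @ t # v \<and> (\<forall>x\<in>set v. t \<otimes> x = x \<otimes> t)" if t: "t \<in> S" "?g t < 0" for t
    proof (cases "t = s")
      case True
      then show ?thesis by (intro exI[of _ w] exI[of _ "[]"]) simp
    next
      case False
      then have *: "s \<otimes> t = t \<otimes> s" "?f t < 0" using neg t by blast+
      then obtain u v where "w = u @ t # v" "\<forall>x\<in>set v. t \<otimes> x = x \<otimes> t" using IH t by blast
      then show ?thesis using * by (intro exI[of _ u] exI[of _ "v @ [s]"]) simp
    qed
    show "?g (last (w @ [s])) < 0" using gs pos by simp
  qed
qed

text \<open>The functional with all values 1 lies inside the fundamental chamber, so its stabilizer
  is trivial: a nonempty reduced word sends it to a functional that is negative at the last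
  letter.\<close>

lemma acts_faithful:
  assumes "u \<in> lists S" "v \<in> lists S" "\<And>s. s \<in> S \<Longrightarrow> acts u (\<lambda>_. 1) s = acts v (\<lambda>_. 1) s"
  shows "wv u = wv v"
proof -
  have uv: "wv u \<in> carrier G" "wv v \<in> carrier G" using assms by auto
  obtain w where w: "reduced w" "wv w = wv u \<otimes> inv (wv v)"
    using reduced_exists[of "wv u \<otimes> inv (wv v)"] uv by auto
  have wS: "w \<in> lists S" using w by (simp add: reduced_def)
  have "wv w = wv (u @ rev v)" using w(2) assms(1,2) by (simp add: wv_append wv_rev)
  then have eq: "acts w = acts (u @ rev v)"
    by (intro acts_cong) (use wS assms(1,2) in auto)
  have "w = []"
  proof (rule ccontr)
    assume "w \<noteq> []"
    then have last: "last w \<in> S" using wS by auto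
    \<comment> \<open>Divisibility by 0 is equality, so this is the congruence lemma used for equal
      values on \<open>S\<close>.\<close>
    have "0 dvd acts (rev v) (acts u (\<lambda>_. 1)) (last w) - acts (rev v) (acts v (\<lambda>_. 1)) (last w)"
      by (rule acts_dvd) (use assms last in auto)
    then have "acts w (\<lambda>_. 1) (last w) = 1" by (simp add: eq)
    then show False using reduced_signs[OF w(1)] \<open>w \<noteq> []\<close> by auto
  qed
  then have "\<one> \<otimes> wv v = wv u \<otimes> inv (wv v) \<otimes> wv v" using w by simp
  then show ?thesis using uv by (simp add: m_assoc)
qed

text \<open>
  Walls are coloured globally: infinitely many walls may be close to a given one, so a greedy colouring
  would not do. The factor \<open>g\<close> is arbitrary since it acts invertibly modulo \<open>3\<^sup>2\<^sup>R\<^sup>+\<^sup>1\<close>, while the values of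
  short words are smaller than the modulus.
\<close>

lemma wall_colouring:
  fixes R :: nat
  shows "\<exists>col. (\<forall>x\<in>carrier G. col x < (3::nat) ^ ((2 * R + 1) * (card S)\<^sup>2)) \<and>
    (\<forall>g\<in>carrier G. \<forall>a\<in>lists S. \<forall>b\<in>lists S. length a \<le> 2 * R \<longrightarrow> length b \<le> 2 * R \<longrightarrow>
      col (g \<otimes> wv a \<otimes> inv g) = col (g \<otimes> wv b \<otimes> inv g) \<longrightarrow> wv a = wv b)"
proof -
  define q :: nat where "q = 3 ^ (2 * R + 1)"
  define word where "word x = (SOME w. w \<in> lists S \<and> wv w = x)" for x
  have word: "word x \<in> lists S \<and> wv (word x) = x" if "x \<in> carrier G" for x
    unfolding word_def by (rule someI_ex) (use wv_surj[OF that] in blast)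
  \<comment> \<open>The matrix of \<open>x\<close> modulo \<open>q\<close>; the colour is its number
    in an enumeration of all such matrices. The word chosen for \<open>x\<close> has no influence,
    by \<open>acts_cong\<close>.\<close>
  define M where "M x = (\<lambda>(s, u) \<in> S \<times> S. nat (acts (word x) (\<lambda>t. if t = s then 1 else 0) u mod int q))" for x
  let ?X = "S \<times> S \<rightarrow>\<^sub>E {..<q}"
  have "q > 0" by (simp add: q_def)
  then have M_in: "M x \<in> ?X" for x
    unfolding M_def by (auto simp: nat_less_iff)
  have "card ?X = q ^ (card S)\<^sup>2"
    using finite_S by (simp add: card_PiE card_cartesian_product power2_eq_square)
  also have "\<dots> = 3 ^ ((2 * R + 1) * (card S)\<^sup>2)" by (simp only: q_def power_mult)
  finally have card: "card ?X = 3 ^ ((2 * R + 1) * (card S)\<^sup>2)" .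
  have fin: "finite ?X" using finite_S by (intro finite_PiE) auto
  then obtain e where e: "bij_betw e ?X {0..<card ?X}" using ex_bij_betw_finite_nat by blast
  show ?thesis
  proof (intro exI[of _ "\<lambda>x. e (M x)"] conjI ballI impI)
    show "e (M x) < 3 ^ ((2 * R + 1) * (card S)\<^sup>2)" for x
      using bij_betwE[OF e] M_in[of x] card by auto
    fix g a b
    assume g: "g \<in> carrier G" and ab: "a \<in> lists S" "b \<in> lists S" "length a \<le> 2 * R" "length b \<le> 2 * R"
      and eq: "e (M (g \<otimes> wv a \<otimes> inv g)) = e (M (g \<otimes> wv b \<otimes> inv g))"
    let ?x = "g \<otimes> wv a \<otimes> inv g" and ?y = "g \<otimes> wv b \<otimes> inv g"
    have "M ?x = M ?y" using e eq M_in by (auto simp: bij_betw_def inj_on_def)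
    then have "nat (acts (word ?x) (\<lambda>t. if t = s then 1 else 0) u mod int q) =
        nat (acts (word ?y) (\<lambda>t. if t = s then 1 else 0) u mod int q)" if "s \<in> S" "u \<in> S" for s u
      using that by (auto simp: M_def fun_eq_iff restrict_def split: if_splits)
    then have "acts (word ?x) (\<lambda>t. if t = s then 1 else 0) u mod int q =
        acts (word ?y) (\<lambda>t. if t = s then 1 else 0) u mod int q" if "s \<in> S" "u \<in> S" for s u
      using that \<open>q > 0\<close> by (simp add: eq_nat_nat_iff)
    then have dvd0: "int q dvd acts (word ?x) (\<lambda>t. if t = s then 1 else 0) u -
        acts (word ?y) (\<lambda>t. if t = s then 1 else 0) u" if "s \<in> S" "u \<in> S" for s u
      using that by (simp add: mod_eq_dvd_iff)
    have xy: "?x \<in> carrier G" "?y \<in> carrier G" using g ab by auto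
    have dvd: "int q dvd acts (word ?x) f u - acts (word ?y) f u" if "u \<in> S" for f u
    proof -
      have "acts (word ?x) f u - acts (word ?y) f u = (\<Sum>s\<in>S. f s *
        (acts (word ?x) (\<lambda>t. if t = s then 1 else 0) u - acts (word ?y) (\<lambda>t. if t = s then 1 else 0) u))"
        using acts_linear[of "word ?x" u f] acts_linear[of "word ?y" u f] word xy that
        by (simp add: right_diff_distrib sum_subtractf)
      also have "int q dvd \<dots>" using dvd0 that by (intro dvd_sum dvd_mult) auto
      finally show ?thesis .
    qed
    obtain c where c: "c \<in> lists S" "wv c = g" using wv_surj[OF g] by blast
    have wx: "acts (word ?x) = acts (c @ a @ rev c)"
      by (rule acts_cong) (use word[OF xy(1)] c ab in \<open>auto simp: wv_append wv_rev m_assoc\<close>)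
    have wy: "acts (word ?y) = acts (c @ b @ rev c)"
      by (rule acts_cong) (use word[OF xy(2)] c ab in \<open>auto simp: wv_append wv_rev m_assoc\<close>)
    show "wv a = wv b"
    proof (rule acts_faithful[OF ab(1,2)])
      fix s assume s: "s \<in> S"
      \<comment> \<open>Conjugating back by \<open>c\<close> turns the congruence for the two walls
        into one for the short words \<open>a\<close> and \<open>b\<close>.\<close>
      have "int q dvd acts c (acts (word ?x) (acts (rev c) (\<lambda>_. 1))) s - acts c (acts (word ?y) (acts (rev c) (\<lambda>_. 1))) s"
        by (rule acts_dvd[OF c(1) _ s]) (rule dvd)
      then have d: "int q dvd acts a (\<lambda>_. 1) s - acts b (\<lambda>_. 1) s" by (simp add: wx wy)
      \<comment> \<open>Two values of size at most \<open>3 ^ (2 * R)\<close> differ by less than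
        \<open>q = 3 ^ (2 * R + 1)\<close>, so congruent values are equal.\<close>
      have "\<bar>acts w (\<lambda>_. 1) s\<bar> \<le> 3 ^ (2 * R)" if "length w \<le> 2 * R" for w
        by (rule order_trans[OF acts_bound[of _ 1]]) (use power_increasing[OF that, of "3::int"] in auto)
      from this[OF ab(3)] this[OF ab(4)]
      have "\<bar>acts a (\<lambda>_. 1) s - acts b (\<lambda>_. 1) s\<bar> \<le> 3 ^ (2 * R) + 3 ^ (2 * R)" by linarith
      also have "\<dots> < int q" by (simp add: q_def)
      finally have "\<bar>acts a (\<lambda>_. 1) s - acts b (\<lambda>_. 1) s\<bar> < int q" .
      then show "acts a (\<lambda>_. 1) s = acts b (\<lambda>_. 1) s"
        using d dvd_imp_le_int[of "acts a (\<lambda>_. 1) s - acts b (\<lambda>_. 1) s" "int q"] by fastforce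
    qed
  qed
qed

end

section \<open>Walls\<close>

text \<open>Multiplication by a letter in the free product of groups of order two, one for each
  letter. The normal forms are the lists with \<open>distinct_adj\<close>, and
  \<open>free_reduce\<close> computes them.\<close>

fun push :: "'a \<Rightarrow> 'a list \<Rightarrow> 'a list" where
  "push x [] = [x]"
| "push x (y # ys) = (if x = y then ys else x # y # ys)"

definition free_reduce :: "'a list \<Rightarrow> 'a list"
  where "free_reduce xs = foldr push xs []"

lemma distinct_adj_push: "distinct_adj ys \<Longrightarrow> distinct_adj (push x ys)"
  by (cases ys) (auto dest: distinct_adj_ConsD)

lemma push_push: "distinct_adj ys \<Longrightarrow> push x (push x ys) = ys"
  by (cases "(x, ys)" rule: push.cases) (auto simp: distinct_adj_Cons neq_Nil_conv split: list.splits,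
      metis list.sel(1) push.elims)

lemma distinct_adj_free_reduce: "distinct_adj (free_reduce xs)"
  unfolding free_reduce_def by (induction xs) (auto intro: distinct_adj_push)

lemma free_reduce_cancel: "free_reduce (xs @ x # x # ys) = free_reduce (xs @ ys)"
  using push_push[OF distinct_adj_free_reduce, of x ys] by (simp add: free_reduce_def)

lemma free_reduce_id: "distinct_adj xs \<Longrightarrow> free_reduce xs = xs"
proof (induction xs)
  case (Cons x xs)
  then have "free_reduce (x # xs) = push x xs"
    by (auto simp: free_reduce_def dest: distinct_adj_ConsD)
  then show ?case using Cons.prems by (cases xs) auto
qed (simp add: free_reduce_def)

text \<open>In a product of two normal forms an end of the first cancels against a beginning of the
  second. Letters are involutions, so the inverse of \<open>a\<close> is
  \<open>rev a\<close>.\<close>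

lemma free_reduce_append:
  assumes "distinct_adj xs" "distinct_adj ys"
  shows "\<exists>p a b. xs = p @ a \<and> ys = rev a @ b \<and> free_reduce (xs @ ys) = p @ b"
  using assms
proof (induction xs arbitrary: ys rule: rev_induct)
  case Nil
  then show ?case using free_reduce_id by force
next
  case (snoc x xs)
  show ?case
  proof (cases "ys \<noteq> [] \<and> hd ys = x")
    case True
    then obtain ys' where ys: "ys = x # ys'" by (cases ys) auto
    have "distinct_adj xs" "distinct_adj ys'"
      using snoc.prems ys by (auto dest: distinct_adj_ConsD)
    then obtain p a b where "xs = p @ a" "ys' = rev a @ b" "free_reduce (xs @ ys') = p @ b"
      using snoc.IH by blast
    then show ?thesis
      using ys free_reduce_cancel[of xs x ys'] by (intro exI[of _ p] exI[of _ "a @ [x]"] exI[of _ b]) simp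
  next
    case False
    then have "distinct_adj ((xs @ [x]) @ ys)"
      using snoc.prems unfolding distinct_adj_append_iff[of "xs @ [x]"] by auto
    then show ?thesis
      using free_reduce_id by (intro exI[of _ "xs @ [x]"] exI[of _ "[]"] exI[of _ ys]) auto
  qed
qed

section \<open>The walls of one colour crossed by a path\<close>

context racg begin

fun walls :: "('g \<Rightarrow> nat) \<Rightarrow> nat \<Rightarrow> 'g \<Rightarrow> 'g list \<Rightarrow> 'g list" where
  "walls c i g [] = []"
| "walls c i g (s # w) = (if c s = i then [g \<otimes> s \<otimes> inv g] else []) @ walls c i (g \<otimes> s) w"

lemma walls_append:
  "g \<in> carrier G \<Longrightarrow> u \<in> lists S \<Longrightarrow> walls c i g (u @ v) = walls c i g u @ walls c i (g \<otimes> wv u) v"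
  by (induction u arbitrary: g rule: list.induct) (auto simp: S_carrier m_assoc)

text \<open>Inserting \<open>s s\<close> repeats one wall twice in a row. Swapping commuting letters
  keeps the wall of each, and as their colours differ, no list of a single colour notices the
  swap.\<close>

lemma walls_free_reduce_cong:
  assumes "colouring G S n c" "u \<in> lists S" "v \<in> lists S" "wv u = wv v"
  shows "free_reduce (walls c i \<one> u) = free_reduce (walls c i \<one> v)"
proof (rule word_invariant[OF assms(2-4)])
  fix a b s assume ab: "a \<in> lists S" "b \<in> lists S" "s \<in> S"
  let ?g = "wv a"
  have "?g \<otimes> s \<otimes> s \<otimes> inv (?g \<otimes> s) = ?g \<otimes> s \<otimes> inv ?g"
    using ab by (simp add: S_carrier m_assoc inv_mult_group inv_S S_sq)
  moreover have "?g \<otimes> s \<otimes> s = ?g" using ab by (simp add: S_carrier m_assoc S_sq)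
  ultimately show "free_reduce (walls c i \<one> (a @ [s, s] @ b)) = free_reduce (walls c i \<one> (a @ b))"
    using ab free_reduce_cancel[of "walls c i \<one> a" "?g \<otimes> s \<otimes> inv ?g" "walls c i ?g b"]
    by (auto simp: walls_append)
next
  fix a b s t assume ab: "a \<in> lists S" "b \<in> lists S" "s \<in> S" "t \<in> S" "s \<noteq> t" "s \<otimes> t = t \<otimes> s"
  let ?g = "wv a"
  have conj: "?g \<otimes> s \<otimes> t \<otimes> inv (?g \<otimes> s) = ?g \<otimes> t \<otimes> inv ?g"
    if "s \<in> S" "t \<in> S" "s \<otimes> t = t \<otimes> s" for s t
  proof -
    have "?g \<otimes> s \<otimes> t \<otimes> inv (?g \<otimes> s) = ?g \<otimes> (s \<otimes> t) \<otimes> (s \<otimes> inv ?g)"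
      using ab that by (simp add: S_carrier m_assoc inv_mult_group inv_S)
    also have "\<dots> = ?g \<otimes> t \<otimes> (s \<otimes> s) \<otimes> inv ?g"
      unfolding that(3) using ab that by (simp add: S_carrier m_assoc)
    finally show ?thesis using ab that by (simp add: S_carrier S_sq)
  qed
  have "?g \<otimes> s \<otimes> t = ?g \<otimes> (s \<otimes> t)" "?g \<otimes> t \<otimes> s = ?g \<otimes> (t \<otimes> s)"
    using ab by (simp_all add: S_carrier m_assoc)
  then have "?g \<otimes> s \<otimes> t = ?g \<otimes> t \<otimes> s" using ab by simp
  moreover have "c s \<noteq> c t" using assms(1) ab by (auto simp: colouring_def)
  ultimately have "walls c i \<one> (a @ [s, t] @ b) = walls c i \<one> (a @ [t, s] @ b)"
    using ab conj[of s t] conj[of t s] by (auto simp: walls_append)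
  then show "free_reduce (walls c i \<one> (a @ [s, t] @ b)) = free_reduce (walls c i \<one> (a @ [t, s] @ b))"
    by simp
qed

text \<open>Walls near \<open>g\<close> are conjugates by \<open>g\<close> of short elements, the
  form in which \<open>wall_colouring\<close> tells them apart.\<close>

lemma in_wallsE:
  assumes "x \<in> set (walls c i g w)" "g \<in> carrier G" "w \<in> lists S"
  obtains u s v where "w = u @ s # v" "x = g \<otimes> (wv u \<otimes> s \<otimes> inv (wv u)) \<otimes> inv g"
  using assms
proof (induction w arbitrary: thesis rule: rev_induct)
  case (snoc t w)
  then have w: "w \<in> lists S" "t \<in> S" by auto
  consider "x \<in> set (walls c i g w)" | "x = (g \<otimes> wv w) \<otimes> t \<otimes> inv (g \<otimes> wv w)"
    using snoc.prems(2) walls_append[OF assms(2) w(1)] by (auto split: if_splits)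
  then show ?case
  proof cases
    case 1
    then obtain u s v where "w = u @ s # v" "x = g \<otimes> (wv u \<otimes> s \<otimes> inv (wv u)) \<otimes> inv g"
      using snoc.IH assms(2) w(1) by blast
    then show ?thesis by (intro snoc.prems(1)[of u s "v @ [t]"]) auto
  next
    case 2
    then have "x = g \<otimes> (wv w \<otimes> t \<otimes> inv (wv w)) \<otimes> inv g"
      using w assms(2) by (simp add: S_carrier m_assoc inv_mult_group)
    then show ?thesis by (intro snoc.prems(1)[of w t "[]"]) auto
  qed
qed auto

lemma distinct_walls:
  "reduced w \<Longrightarrow> g \<in> carrier G \<Longrightarrow> distinct (walls c i g w)"
proof (induction w rule: rev_induct)
  case (snoc t w)
  then have w: "w \<in> lists S" "t \<in> S" by (auto simp: reduced_def)
  have "(g \<otimes> wv w) \<otimes> t \<otimes> inv (g \<otimes> wv w) \<notin> set (walls c i g w)"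
  proof
    assume "(g \<otimes> wv w) \<otimes> t \<otimes> inv (g \<otimes> wv w) \<in> set (walls c i g w)"
    then obtain u s v where u: "w = u @ s # v"
      "(g \<otimes> wv w) \<otimes> t \<otimes> inv (g \<otimes> wv w) = g \<otimes> (wv u \<otimes> s \<otimes> inv (wv u)) \<otimes> inv g"
      using in_wallsE snoc.prems(2) w(1) by metis
    have us: "u \<in> lists S" "s \<in> S" using u(1) w by auto
    have "g \<otimes> (wv w \<otimes> t \<otimes> inv (wv w)) \<otimes> inv g = g \<otimes> (wv u \<otimes> s \<otimes> inv (wv u)) \<otimes> inv g"
      using u(2) w snoc.prems(2) by (simp add: S_carrier m_assoc inv_mult_group)
    then have "wv w \<otimes> t \<otimes> inv (wv w) = wv u \<otimes> s \<otimes> inv (wv u)"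
      using w us snoc.prems(2) by (simp add: S_carrier right_cancel)
    then show False using reduced_no_wall_twice[of u s v t "[]"] snoc.prems(1) u(1) by simp
  qed
  then show ?case
    using snoc.IH[OF reduced_append1[OF snoc.prems(1)] snoc.prems(2)] walls_append[OF snoc.prems(2) w(1)]
    by auto
qed simp

text \<open>Each letter contributes its wall to exactly one of the \<open>n\<close> lists.\<close>

lemma sum_length_walls:
  assumes "colouring G S n c" "w \<in> lists S"
  shows "(\<Sum>i=1..n. length (walls c i g w)) = length w"
  using assms(2)
proof (induction w arbitrary: g rule: list.induct)
  case (Cons s w)
  have "c s \<in> {1..n}" using assms(1) Cons.prems by (auto simp: colouring_def)
  moreover have "(\<Sum>i=1..n. length (walls c i g (s # w))) =
      (\<Sum>i=1..n. (if c s = i then 1 else 0)) + (\<Sum>i=1..n. length (walls c i (g \<otimes> s) w))"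
    by (subst sum.distrib[symmetric]) (rule sum.cong, auto)
  ultimately show ?case using Cons by simp
qed simp

text \<open>The word \<open>u @ w\<close> represents the same element as \<open>v\<close>, so the
  list of \<open>v\<close> is the free reduction of the lists of \<open>u\<close> and
  \<open>w\<close> joined. All three lists are repetition-free, hence normal forms, and only one
  cancellation occurs where they meet.\<close>

lemma walls_geodesic:
  assumes col: "colouring G S n c" and u: "reduced u" and v: "reduced v" and w: "reduced w"
    and eq: "wv v = wv u \<otimes> wv w"
  shows "\<exists>p a b. walls c i \<one> u = p @ a \<and> walls c i \<one> v = p @ b \<and> walls c i (wv u) w = rev a @ b"
proof -
  have S: "u \<in> lists S" "v \<in> lists S" "w \<in> lists S" using u v w by (auto simp: reduced_def)
  have dist: "distinct (walls c i \<one> u)" "distinct (walls c i \<one> v)" "distinct (walls c i (wv u) w)"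
    using distinct_walls u v w S by auto
  have adj: "distinct_adj xs" if "distinct xs" for xs :: "'g list"
    using that by (simp add: distinct_adj_conv_nth nth_eq_iff_index_eq)
  have "free_reduce (walls c i \<one> (u @ w)) = free_reduce (walls c i \<one> v)"
    by (rule walls_free_reduce_cong[OF col]) (use S eq in \<open>auto simp: wv_append\<close>)
  then have "free_reduce (walls c i \<one> u @ walls c i (wv u) w) = walls c i \<one> v"
    using S free_reduce_id[OF adj[OF dist(2)]] by (simp add: walls_append)
  then show ?thesis using free_reduce_append[OF adj[OF dist(1)] adj[OF dist(3)]] by metis
qed

text \<open>The isometric embedding into \<open>n\<close> trees of lists: \<open>m i\<close> is the
  level at which the \<open>i\<close>-th coordinates of \<open>g\<close> and \<open>h\<close> part.
  The walls beyond it separate \<open>g\<close> from \<open>h\<close>, which is why they are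
  distinct and near \<open>g\<close>.\<close>

lemma tree_coordinates:
  assumes col: "colouring G S n c"
  obtains X :: "nat \<Rightarrow> 'g \<Rightarrow> 'g list"
  where "\<And>i g. g \<in> carrier G \<Longrightarrow> set (X i g) \<subseteq> carrier G"
    and "\<And>g h. g \<in> carrier G \<Longrightarrow> h \<in> carrier G \<Longrightarrow> \<exists>N m. graph_dist (cayley_adj G S) g h = real N \<and>
      (\<Sum>i=1..n. (length (X i g) - m i) + (length (X i h) - m i)) = N \<and>
      (\<forall>i. m i \<le> length (X i g) \<and> m i \<le> length (X i h) \<and> take (m i) (X i g) = take (m i) (X i h) \<and>
        (\<forall>x\<in>set (drop (m i) (X i g)). \<forall>y\<in>set (drop (m i) (X i h)). x \<noteq> y \<and>
          (\<exists>a\<in>lists S. \<exists>b\<in>lists S. length a \<le> 2 * N \<and> length b \<le> 2 * N \<and>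
            x = g \<otimes> wv a \<otimes> inv g \<and> y = g \<otimes> wv b \<otimes> inv g)))"
proof -
  define rw where "rw x = (SOME w. reduced w \<and> wv w = x)" for x
  have rw: "reduced (rw x)" "wv (rw x) = x" if "x \<in> carrier G" for x
  proof -
    have "reduced (rw x) \<and> wv (rw x) = x"
      unfolding rw_def by (rule someI_ex) (use reduced_exists[OF that] in blast)
    then show "reduced (rw x)" "wv (rw x) = x" by auto
  qed
  show ?thesis
  proof (rule that[of "\<lambda>i g. walls c i \<one> (rw g)"])
    show "set (walls c i \<one> (rw g)) \<subseteq> carrier G" if g: "g \<in> carrier G" for i g
    proof
      fix x assume x: "x \<in> set (walls c i \<one> (rw g))"
      have S: "rw g \<in> lists S" using rw[OF g] by (simp add: reduced_def)
      obtain u s v where "rw g = u @ s # v" "x = \<one> \<otimes> (wv u \<otimes> s \<otimes> inv (wv u)) \<otimes> inv \<one>"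
        using in_wallsE[OF x one_closed S] by blast
      then show "x \<in> carrier G" using S by (auto simp: S_carrier)
    qed
    fix g h assume g: "g \<in> carrier G" and h: "h \<in> carrier G"
    obtain w where w: "reduced w" "h = g \<otimes> wv w" "graph_dist (cayley_adj G S) g h = length w"
      using geodesic_word[OF g h] by blast
    have wS: "w \<in> lists S" using w by (simp add: reduced_def)
    have "\<exists>p a b. walls c i \<one> (rw g) = p @ a \<and> walls c i \<one> (rw h) = p @ b \<and> walls c i g w = rev a @ b" for i
      using walls_geodesic[OF col rw(1)[OF g] rw(1)[OF h] w(1), of i] rw(2) g h w(2) by simp
    then obtain p a b where pab: "\<And>i. walls c i \<one> (rw g) = p i @ a i" "\<And>i. walls c i \<one> (rw h) = p i @ b i"
      "\<And>i. walls c i g w = rev (a i) @ b i" by metis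
    have "(\<Sum>i=1..n. length (a i) + length (b i)) = length w"
      using sum_length_walls[OF col wS, of g] by (simp add: pab(3))
    moreover have "x \<noteq> y" if "x \<in> set (a i)" "y \<in> set (b i)" for i x y
      using distinct_walls[OF w(1) g, of c i] that by (auto simp: pab(3))
    moreover have "\<exists>z\<in>lists S. length z \<le> 2 * length w \<and> x = g \<otimes> wv z \<otimes> inv g"
      if "x \<in> set (a i) \<union> set (b i)" for i x
    proof -
      have "x \<in> set (walls c i g w)" using that by (auto simp: pab(3))
      then obtain u s v where u: "w = u @ s # v" "x = g \<otimes> (wv u \<otimes> s \<otimes> inv (wv u)) \<otimes> inv g"
        using in_wallsE[OF _ g wS] by blast
      \<comment> \<open>With \<open>u @ [s]\<close> a prefix of \<open>w\<close>, this word has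
        length at most \<open>2 * N - 1\<close>.\<close>
      then have "x = g \<otimes> wv (u @ s # rev u) \<otimes> inv g" "u @ s # rev u \<in> lists S"
        using wS by (auto simp: wv_append wv_rev S_carrier m_assoc)
      then show ?thesis using u(1) by (intro bexI[of _ "u @ s # rev u"]) auto
    qed
    ultimately show "\<exists>N m. graph_dist (cayley_adj G S) g h = real N \<and>
      (\<Sum>i=1..n. (length (walls c i \<one> (rw g)) - m i) + (length (walls c i \<one> (rw h)) - m i)) = N \<and>
      (\<forall>i. m i \<le> length (walls c i \<one> (rw g)) \<and> m i \<le> length (walls c i \<one> (rw h)) \<and>
        take (m i) (walls c i \<one> (rw g)) = take (m i) (walls c i \<one> (rw h)) \<and>
        (\<forall>x\<in>set (drop (m i) (walls c i \<one> (rw g))). \<forall>y\<in>set (drop (m i) (walls c i \<one> (rw h))). x \<noteq> y \<and>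
          (\<exists>a\<in>lists S. \<exists>b\<in>lists S. length a \<le> 2 * N \<and> length b \<le> 2 * N \<and>
            x = g \<otimes> wv a \<otimes> inv g \<and> y = g \<otimes> wv b \<otimes> inv g)))"
      using w(3) by (intro exI[of _ "length w"] exI[of _ "\<lambda>i. length (p i)"]) (simp add: pab(1,2), blast)
  qed
qed

end

section \<open>Labels\<close>

definition ruler :: "nat \<Rightarrow> nat" where "ruler k = multiplicity 2 k"

lemma ruler_eq: "ruler (2 ^ v * Suc (2 * y)) = v"
  unfolding ruler_def
proof (rule multiplicity_eqI)
  show "\<not> 2 ^ Suc v dvd 2 ^ v * Suc (2 * y)"
    unfolding power_Suc2 by (subst dvd_times_left_cancel_iff) auto
qed simp

lemma ruler_dvd: "2 ^ ruler k dvd k"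
  unfolding ruler_def by (rule multiplicity_dvd)

text \<open>
  Write \<open>k = p + 2\<^sup>v (2 y + 1) P\<close> with \<open>p < P\<close>. Level \<open>k\<close> stores digit \<open>p\<close> of the colour at scale \<open>v\<close> of the
  entry at level \<open>2\<^sup>v\<^sup>+\<^sup>1 y P\<close>, called its anchor.
\<close>

locale level_code =
  fixes W :: "'w set" and col :: "nat \<Rightarrow> 'w \<Rightarrow> nat" and D P c :: nat
  assumes col: "x \<in> W \<Longrightarrow> col R x < 3 ^ ((2 * R + 1) * D)" and P: "P > 0"
begin

definition scale :: "nat \<Rightarrow> nat" where "scale v = c * P * 2 ^ v"

text \<open>An injective way to write a colour at scale \<open>v\<close> with \<open>P\<close>
  digits, whose base has about the \<open>P\<close>-th part of the exponent of the number of
  colours.\<close>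

definition digit :: "nat \<Rightarrow> nat \<Rightarrow> nat \<Rightarrow> nat"
  where "digit v = (SOME f. inj_on f {..<3 ^ ((2 * scale v + 1) * D)} \<and>
    f ` {..<3 ^ ((2 * scale v + 1) * D)} \<subseteq> {..<P} \<rightarrow>\<^sub>E {..<3 ^ ((2 * c * 2 ^ v + 1) * D)})"

lemma digit:
  "inj_on (digit v) {..<3 ^ ((2 * scale v + 1) * D)}"
  "digit v ` {..<3 ^ ((2 * scale v + 1) * D)} \<subseteq> {..<P} \<rightarrow>\<^sub>E {..<3 ^ ((2 * c * 2 ^ v + 1) * D)}"
proof -
  let ?A = "{..<(3::nat) ^ ((2 * scale v + 1) * D)}"
  let ?B = "{..<P} \<rightarrow>\<^sub>E {..<(3::nat) ^ ((2 * c * 2 ^ v + 1) * D)}"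
  have "(2 * scale v + 1) * D \<le> (2 * c * 2 ^ v + 1) * D * P"
  proof -
    have "D \<le> D * P" using P by simp
    then show ?thesis by (simp add: scale_def algebra_simps)
  qed
  then have "card ?A \<le> card ?B"
    by (simp add: card_PiE power_increasing flip: power_mult)
  then have "\<exists>f. inj_on f ?A \<and> f ` ?A \<subseteq> ?B"
    using card_le_inj[of ?A ?B] by (auto simp: finite_PiE)
  then have "inj_on (digit v) ?A \<and> digit v ` ?A \<subseteq> ?B"
    unfolding digit_def by (rule someI_ex)
  then show "inj_on (digit v) ?A" "digit v ` ?A \<subseteq> ?B" by auto
qed

definition anchor :: "nat \<Rightarrow> nat"
  where "anchor k = (k div P - 2 ^ ruler (k div P)) * P"

lemma anchor_le: "anchor k \<le> k"
proof -
  have "anchor k \<le> k div P * P" unfolding anchor_def by (rule mult_le_mono1) simp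
  then show ?thesis by (meson div_times_less_eq_dividend le_trans)
qed

text \<open>Levels below \<open>P\<close> have \<open>k div P = 0\<close> and store the default
  0.\<close>

definition piece :: "'w list \<Rightarrow> nat \<Rightarrow> nat"
  where "piece X k = (if k < P then 0 else
    digit (ruler (k div P)) (col (scale (ruler (k div P))) (X ! anchor k)) (k mod P))"

text \<open>A two-digit number in mixed radix: the colour at the fixed scale 0 controls small
  distances, the stored piece large ones.\<close>

definition label :: "'w list \<Rightarrow> nat \<Rightarrow> nat"
  where "label X k = col (scale 0) (X ! k) + 3 ^ ((2 * scale 0 + 1) * D) * piece X k"

text \<open>A label depends only on entries up to its own level, since the anchor is not
  later.\<close>

lemma label_cong:
  assumes "take m X = take m Y" "k < m"
  shows "label X k = label Y k"
proof -
  have "X ! j = Y ! j" if "j < m" for j using assms(1) that by (metis nth_take)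
  then show ?thesis using anchor_le[of k] assms(2) by (simp add: label_def piece_def)
qed

lemma label_eq:
  assumes "X ! k \<in> W" "Y ! k \<in> W" "label X k = label Y k"
  shows "col (scale 0) (X ! k) = col (scale 0) (Y ! k) \<and> piece X k = piece Y k"
proof -
  let ?K = "(3::nat) ^ ((2 * scale 0 + 1) * D)"
  have "col (scale 0) (X ! k) < ?K" "col (scale 0) (Y ! k) < ?K" using assms col by auto
  moreover have "label X k mod ?K = label Y k mod ?K" "label X k div ?K = label Y k div ?K"
    using assms(3) by simp_all
  ultimately show ?thesis by (simp add: label_def)
qed

text \<open>The second half of the block begins with \<open>P\<close> levels that hold all digits of
  the colour of the first entry of the block.\<close>

lemma label_block:
  fixes y v :: nat
  defines "b \<equiv> 2 ^ Suc v * P"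
  assumes "set X \<subseteq> W" "set Y \<subseteq> W" "Suc y * b \<le> length X" "Suc y * b \<le> length Y"
    and eq: "\<And>k. y * b \<le> k \<Longrightarrow> k < Suc y * b \<Longrightarrow> label X k = label Y k"
  shows "col (scale v) (X ! (y * b)) = col (scale v) (Y ! (y * b))"
proof -
  have b: "b > 0" using P by (simp add: b_def)
  have in_W: "X ! k \<in> W" "Y ! k \<in> W" if "k < Suc y * b" for k
    using assms(2-5) that by (auto simp: subset_iff)
  have yb: "y * b < Suc y * b" using b by simp
  let ?x = "col (scale v) (X ! (y * b))" and ?y = "col (scale v) (Y ! (y * b))"
  have xy: "?x \<in> {..<3 ^ ((2 * scale v + 1) * D)}" "?y \<in> {..<3 ^ ((2 * scale v + 1) * D)}"
    using col in_W[OF yb] by auto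
  have "digit v ?x p = digit v ?y p" if p: "p < P" for p
  proof -
    define k where "k = 2 ^ v * Suc (2 * y) * P + p"
    have div: "k div P = 2 ^ v * Suc (2 * y)" "k mod P = p" using p by (simp_all add: k_def)
    have r: "ruler (k div P) = v" unfolding div by (rule ruler_eq)
    have "anchor k = (2 ^ v * Suc (2 * y) - 2 ^ v) * P" unfolding anchor_def r by (simp only: div)
    then have a: "anchor k = y * b" by (simp add: b_def mult_ac)
    have "1 * P \<le> 2 ^ v * Suc (2 * y) * P" by (rule mult_le_mono1) (simp only: One_nat_def Suc_le_eq, simp)
    then have "P \<le> k" unfolding k_def nat_mult_1 by (rule trans_le_add1)
    then have kP: "\<not> k < P" by simp
    have "p < 2 ^ v * P" using p by (metis less_le_trans mult_le_mono1 nat_mult_1 one_le_power one_le_numeral)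
    then have "k < Suc y * b" "y * b \<le> k" by (simp_all add: k_def b_def algebra_simps)
    then have "piece X k = piece Y k" using label_eq[OF in_W[of k] eq[of k]] by simp
    then show ?thesis using kP by (simp only: piece_def r a div(2) if_False)
  qed
  moreover have "digit v ?x \<in> extensional {..<P}" "digit v ?y \<in> extensional {..<P}"
    using digit(2)[of v] xy by (auto simp: PiE_def subset_iff)
  ultimately have "digit v ?x = digit v ?y" by (auto intro: extensionalityI)
  then show ?thesis using digit(1)[of v] xy by (auto dest: inj_onD)
qed

text \<open>At a level \<open>k\<close> of valuation \<open>v\<close> the digits number
  \<open>3 ^ D * 3 ^ (2 * c * D * 2 ^ v)\<close>. As \<open>2 ^ v * P \<le> k\<close>, the
  assumption on \<open>P\<close> bounds the second factor by
  \<open>exp (\<sigma> * k)\<close>.\<close>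

lemma label_bound:
  assumes \<sigma>: "2 * real c * real D * ln 3 \<le> \<sigma> * real P" "\<sigma> > 0"
    and X: "set X \<subseteq> W" "k < length X"
  shows "real (label X k) < 3 ^ ((2 * scale 0 + 1) * D) * 3 ^ D * exp (\<sigma> * real k)"
proof -
  let ?K = "(3::nat) ^ ((2 * scale 0 + 1) * D)"
  have in_W: "X ! j \<in> W" if "j \<le> k" for j using X that by (auto simp: subset_iff)
  have piece: "real (Suc (piece X k)) \<le> 3 ^ D * exp (\<sigma> * real k)"
  proof (cases "k < P")
    case True
    have "1 * 1 \<le> 3 ^ D * exp (\<sigma> * real k)" using \<sigma>(2) by (intro mult_mono) auto
    then show ?thesis using True by (simp add: piece_def)
  next
    case False
    let ?v = "ruler (k div P)"
    have "digit ?v (col (scale ?v) (X ! anchor k)) \<in> {..<P} \<rightarrow>\<^sub>E {..<3 ^ ((2 * c * 2 ^ ?v + 1) * D)}"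
      using digit(2)[of ?v] col[OF in_W[OF anchor_le]] by blast
    then have "piece X k < 3 ^ ((2 * c * 2 ^ ?v + 1) * D)"
      using False P by (auto simp: piece_def PiE_iff)
    then have "real (Suc (piece X k)) \<le> real (3 ^ ((2 * c * 2 ^ ?v + 1) * D))"
      by (simp only: of_nat_le_iff Suc_le_eq)
    also have "\<dots> = 3 ^ D * 3 ^ (2 * c * D * 2 ^ ?v)"
      by (simp add: algebra_simps flip: power_add)
    also have "(3::real) ^ (2 * c * D * 2 ^ ?v) = exp (2 * real c * real D * ln 3 * 2 ^ ?v)"
    proof -
      have "(3::real) ^ m = exp (real m * ln 3)" for m by (simp add: exp_of_nat_mult)
      then show ?thesis by (simp add: mult_ac)
    qed
    also have "\<dots> \<le> exp (\<sigma> * real k)"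
    proof -
      have "2 ^ ?v \<le> k div P" using ruler_dvd[of "k div P"] False P by (auto intro!: dvd_imp_le simp: div_greater_zero_iff)
      then have "2 ^ ?v * P \<le> k" by (meson div_times_less_eq_dividend le_trans mult_le_mono1)
      then have "real (2 ^ ?v * P) \<le> real k" by (simp only: of_nat_le_iff)
      then have "\<sigma> * (real P * 2 ^ ?v) \<le> \<sigma> * real k" using \<sigma>(2) by (simp add: mult_ac)
      then have "\<sigma> * real P * 2 ^ ?v \<le> \<sigma> * real k" by (simp only: mult.assoc)
      with mult_right_mono[OF \<sigma>(1), of "2 ^ ?v"]
      have "2 * real c * real D * ln 3 * 2 ^ ?v \<le> \<sigma> * real k" by (rule order_trans) simp
      then show ?thesis by simp
    qed
    finally show ?thesis by simp
  qed
  have "label X k < ?K * Suc (piece X k)"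
    using col[OF in_W[of k], of "scale 0"] by (simp add: label_def)
  then have "real (label X k) < real ?K * real (Suc (piece X k))"
    by (simp only: of_nat_mult[symmetric] of_nat_less_iff)
  also have "\<dots> \<le> real ?K * (3 ^ D * exp (\<sigma> * real k))"
    by (rule mult_left_mono[OF piece]) simp
  finally show ?thesis by (simp add: mult.assoc)
qed

end

section \<open>The embedding\<close>

lemma colouring_chromatic_number:
  assumes "finite S"
  shows "\<exists>c. colouring G S (chromatic_number G S) c"
proof -
  obtain e where "bij_betw e S {1..card S}"
    using finite_same_card_bij[of S "{1..card S}"] assms by auto
  then have "colouring G S (card S) e"
    unfolding colouring_def bij_betw_def by (blast dest: inj_onD)
  then have "\<exists>n c. colouring G S n c" by blast
  then show ?thesis unfolding chromatic_number_def by (rule LeastI_ex)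
qed

theorem theorem1p3:
  fixes G :: "('g, 'm) monoid_scheme" and S :: "'g set" and n :: nat
    and V :: "'v set" and E :: "'v \<Rightarrow> 'v \<Rightarrow> bool" and r :: real
  assumes "right_angled_coxeter_group G S"
    and "n = chromatic_number G S"
    and "simplicial_tree V E"
    and "locally_compact_graph V E"
    and "exponentially_branching V E"
    and "r > 0"
  shows "\<exists>\<psi> :: 'g \<Rightarrow> nat \<Rightarrow> 'v.
    bilipschitz_embedding (carrier G) (graph_dist (cayley_adj G S))
      ({1..n} \<rightarrow>\<^sub>E V) (l1_dist n (graph_dist E)) \<psi> \<and>
    (\<forall>x\<in>carrier G.
      isometric_on (Metric_space.mcball (carrier G) (graph_dist (cayley_adj G S)) x r)
        (graph_dist (cayley_adj G S)) (l1_dist n (graph_dist E)) \<psi>)"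
proof -
  interpret racg G S
    using assms(1) by (intro racg.intro racg_axioms.intro) (auto simp: right_angled_coxeter_group_def)
  interpret tree V E using assms(3) by (rule tree.intro)
  let ?d = "graph_dist (cayley_adj G S)"
  interpret M: Metric_space "carrier G" ?d by (rule Metric_space_cayley)
  obtain c where c: "colouring G S n c" using colouring_chromatic_number[OF finite_S] assms(2) by blast
  obtain X :: "nat \<Rightarrow> 'g \<Rightarrow> 'g list" where X: "\<And>i g. g \<in> carrier G \<Longrightarrow> set (X i g) \<subseteq> carrier G"
    and X_dist: "\<And>g h. g \<in> carrier G \<Longrightarrow> h \<in> carrier G \<Longrightarrow> \<exists>N m. ?d g h = real N \<and>
      (\<Sum>i=1..n. (length (X i g) - m i) + (length (X i h) - m i)) = N \<and>
      (\<forall>i. m i \<le> length (X i g) \<and> m i \<le> length (X i h) \<and> take (m i) (X i g) = take (m i) (X i h) \<and>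
        (\<forall>x\<in>set (drop (m i) (X i g)). \<forall>y\<in>set (drop (m i) (X i h)). x \<noteq> y \<and>
          (\<exists>a\<in>lists S. \<exists>b\<in>lists S. length a \<le> 2 * N \<and> length b \<le> 2 * N \<and>
            x = g \<otimes>\<^bsub>G\<^esub> wv a \<otimes>\<^bsub>G\<^esub> inv\<^bsub>G\<^esub> g \<and> y = g \<otimes>\<^bsub>G\<^esub> wv b \<otimes>\<^bsub>G\<^esub> inv\<^bsub>G\<^esub> g)))"
    by (fact tree_coordinates[OF c])
  obtain \<sigma> where \<sigma>: "(\<sigma>::real) > 0" and T: "\<And>K::real. \<exists>F :: nat list \<Rightarrow> 'v. \<forall>A B.
    (\<forall>k<length A. real (A ! k) < K * exp (\<sigma> * real k)) \<longrightarrow> (\<forall>k<length B. real (B ! k) < K * exp (\<sigma> * real k)) \<longrightarrow>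
    F A \<in> V \<and> (\<exists>m. m \<le> length A \<and> m \<le> length B \<and> (\<forall>k<m. A ! k = B ! k) \<and>
      (m < length A \<and> m < length B \<longrightarrow> A ! m \<noteq> B ! m) \<and>
      graph_dist E (F A) (F B) = real (length A - m) + real (length B - m))"
    by (fact tree_coding[OF assms(5)])
  define sep_col where "sep_col R f \<longleftrightarrow> (\<forall>x\<in>carrier G. f x < (3::nat) ^ ((2 * R + 1) * (card S)\<^sup>2)) \<and>
    (\<forall>g\<in>carrier G. \<forall>a\<in>lists S. \<forall>b\<in>lists S. length a \<le> 2 * R \<longrightarrow> length b \<le> 2 * R \<longrightarrow>
      f (g \<otimes>\<^bsub>G\<^esub> wv a \<otimes>\<^bsub>G\<^esub> inv\<^bsub>G\<^esub> g) = f (g \<otimes>\<^bsub>G\<^esub> wv b \<otimes>\<^bsub>G\<^esub> inv\<^bsub>G\<^esub> g) \<longrightarrow> wv a = wv b)" for R f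
  have "\<exists>f. sep_col R f" for R unfolding sep_col_def by (rule wall_colouring)
  then obtain col where sep_col: "\<And>R. sep_col R (col R)" by metis
  have col: "col R x < 3 ^ ((2 * R + 1) * (card S)\<^sup>2)" if "x \<in> carrier G" for R x
    using sep_col[of R] that by (simp add: sep_col_def)
  have col_sep: "wv a = wv b"
    if "g \<in> carrier G" "a \<in> lists S" "b \<in> lists S" "length a \<le> 2 * R" "length b \<le> 2 * R"
      "col R (g \<otimes>\<^bsub>G\<^esub> wv a \<otimes>\<^bsub>G\<^esub> inv\<^bsub>G\<^esub> g) = col R (g \<otimes>\<^bsub>G\<^esub> wv b \<otimes>\<^bsub>G\<^esub> inv\<^bsub>G\<^esub> g)" for R g a b
    using sep_col[of R] that unfolding sep_col_def by blast
  define D where "D = (card S)\<^sup>2"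
  \<comment> \<open>The 32 makes the total loss \<open>4 * n * b\<close> at most half of the
    distance; the added 1 keeps \<open>c'\<close> positive for \<open>n = 0\<close>.\<close>
  define c' where "c' = 32 * n + 1"
  \<comment> \<open>The first bound makes \<open>scale 0\<close> exceed the diameter
    \<open>2 * r\<close> of balls, the second makes the labels fit into the tree.\<close>
  obtain P :: nat where P0: "real P > max (2 * r) (2 * real c' * real D * ln 3 / \<sigma>)" using reals_Archimedean2 by blast
  then have PP: "P > 0" "real P > 2 * r" "2 * real c' * real D * ln 3 \<le> \<sigma> * real P"
    using assms(6) \<sigma> by (auto simp: field_simps)
  interpret level_code "carrier G" col D P c'
    by unfold_locales (use col PP in \<open>auto simp: D_def\<close>)
  define K :: real where "K = 3 ^ ((2 * scale 0 + 1) * D) * 3 ^ D"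
  from T[of K] obtain F :: "nat list \<Rightarrow> 'v" where F: "\<forall>A B.
    (\<forall>k<length A. real (A ! k) < K * exp (\<sigma> * real k)) \<longrightarrow> (\<forall>k<length B. real (B ! k) < K * exp (\<sigma> * real k)) \<longrightarrow>
    F A \<in> V \<and> (\<exists>m. m \<le> length A \<and> m \<le> length B \<and> (\<forall>k<m. A ! k = B ! k) \<and>
      (m < length A \<and> m < length B \<longrightarrow> A ! m \<noteq> B ! m) \<and>
      graph_dist E (F A) (F B) = real (length A - m) + real (length B - m))" ..
  define labels where "labels i g = map (label (X i g)) [0..<length (X i g)]" for i g
  have len: "length (labels i g) = length (X i g)" for i g by (simp add: labels_def)
  have nth: "labels i g ! k = label (X i g) k" if "k < length (X i g)" for i g k
    using that by (simp add: labels_def)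
  have valid: "\<forall>k<length (labels i g). real (labels i g ! k) < K * exp (\<sigma> * real k)" if "g \<in> carrier G" for i g
    using label_bound[OF PP(3) \<sigma> X[OF that]] unfolding len K_def by (simp add: nth)
  define \<psi> where "\<psi> g = (\<lambda>i\<in>{1..n}. F (labels i g))" for g
  let ?e = "l1_dist n (graph_dist E)"
  have \<psi>_in: "\<psi> g \<in> {1..n} \<rightarrow>\<^sub>E V" if "g \<in> carrier G" for g
  proof -
    have "F (labels i g) \<in> V" for i using F valid[OF that] by blast
    then show ?thesis by (auto simp: \<psi>_def)
  qed
  have main: "?e (\<psi> g) (\<psi> h) \<le> ?d g h \<and> ?d g h \<le> 2 * ?e (\<psi> g) (\<psi> h) \<and>
      (?d g h \<le> 2 * r \<longrightarrow> ?e (\<psi> g) (\<psi> h) = ?d g h)" if g: "g \<in> carrier G" and h: "h \<in> carrier G" for g h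
  proof -
    from X_dist[OF g h] obtain N m where Nm: "?d g h = real N \<and>
      (\<Sum>i=1..n. (length (X i g) - m i) + (length (X i h) - m i)) = N \<and>
      (\<forall>i. m i \<le> length (X i g) \<and> m i \<le> length (X i h) \<and> take (m i) (X i g) = take (m i) (X i h) \<and>
        (\<forall>x\<in>set (drop (m i) (X i g)). \<forall>y\<in>set (drop (m i) (X i h)). x \<noteq> y \<and>
          (\<exists>a\<in>lists S. \<exists>b\<in>lists S. length a \<le> 2 * N \<and> length b \<le> 2 * N \<and>
            x = g \<otimes>\<^bsub>G\<^esub> wv a \<otimes>\<^bsub>G\<^esub> inv\<^bsub>G\<^esub> g \<and> y = g \<otimes>\<^bsub>G\<^esub> wv b \<otimes>\<^bsub>G\<^esub> inv\<^bsub>G\<^esub> g)))"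
      by (elim exE) (rule that)
    have N: "?d g h = real N" and sum: "(\<Sum>i=1..n. (length (X i g) - m i) + (length (X i h) - m i)) = N"
      and m: "\<And>i. m i \<le> length (X i g)" "\<And>i. m i \<le> length (X i h)" "\<And>i. take (m i) (X i g) = take (m i) (X i h)"
      and sep: "\<And>i x y. x \<in> set (drop (m i) (X i g)) \<Longrightarrow> y \<in> set (drop (m i) (X i h)) \<Longrightarrow> x \<noteq> y \<and>
          (\<exists>a\<in>lists S. \<exists>b\<in>lists S. length a \<le> 2 * N \<and> length b \<le> 2 * N \<and>
            x = g \<otimes>\<^bsub>G\<^esub> wv a \<otimes>\<^bsub>G\<^esub> inv\<^bsub>G\<^esub> g \<and> y = g \<otimes>\<^bsub>G\<^esub> wv b \<otimes>\<^bsub>G\<^esub> inv\<^bsub>G\<^esub> g)"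
      using Nm by blast+
    \<comment> \<open>Beyond the parting level, entries at the same position are distinct walls near
      \<open>g\<close>, so every scale from \<open>N\<close> on tells them apart.\<close>
    have col_ne: "col R (X i g ! k) \<noteq> col R (X i h ! k)"
      if "N \<le> R" "m i \<le> k" "k < length (X i g)" "k < length (X i h)" for R i k
    proof
      assume eq: "col R (X i g ! k) = col R (X i h ! k)"
      have "X i g ! k \<in> set (drop (m i) (X i g))" "X i h ! k \<in> set (drop (m i) (X i h))"
        using that by (auto simp: in_set_conv_nth intro!: exI[of _ "k - m i"])
      then obtain a b where ab: "X i g ! k \<noteq> X i h ! k" "a \<in> lists S" "b \<in> lists S" "length a \<le> 2 * N" "length b \<le> 2 * N"
        "X i g ! k = g \<otimes>\<^bsub>G\<^esub> wv a \<otimes>\<^bsub>G\<^esub> inv\<^bsub>G\<^esub> g" "X i h ! k = g \<otimes>\<^bsub>G\<^esub> wv b \<otimes>\<^bsub>G\<^esub> inv\<^bsub>G\<^esub> g"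
        using sep by metis
      have "wv a = wv b"
        by (rule col_sep[OF g ab(2,3)]) (use ab(4,5) that(1) eq[unfolded ab(6,7)] in auto)
      then show False using ab(1,6,7) by simp
    qed
    have "\<exists>m'. m' \<le> length (X i g) \<and> m' \<le> length (X i h) \<and> (\<forall>k<m'. label (X i g) k = label (X i h) k) \<and>
      (m' < length (X i g) \<and> m' < length (X i h) \<longrightarrow> label (X i g) m' \<noteq> label (X i h) m') \<and>
      graph_dist E (F (labels i g)) (F (labels i h)) = real (length (X i g) - m') + real (length (X i h) - m')" for i
    proof -
      from F valid[OF g] valid[OF h] obtain k where "k \<le> length (labels i g) \<and> k \<le> length (labels i h) \<and>
        (\<forall>j<k. labels i g ! j = labels i h ! j) \<and>
        (k < length (labels i g) \<and> k < length (labels i h) \<longrightarrow> labels i g ! k \<noteq> labels i h ! k) \<and>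
        graph_dist E (F (labels i g)) (F (labels i h)) =
          real (length (labels i g) - k) + real (length (labels i h) - k)" by blast
      then show ?thesis by (intro exI[of _ k]) (auto simp: len nth)
    qed
    then obtain m' where m': "\<And>i. m' i \<le> length (X i g)" "\<And>i. m' i \<le> length (X i h)"
      "\<And>i k. k < m' i \<Longrightarrow> label (X i g) k = label (X i h) k"
      "\<And>i. m' i < length (X i g) \<Longrightarrow> m' i < length (X i h) \<Longrightarrow> label (X i g) (m' i) \<noteq> label (X i h) (m' i)"
      "\<And>i. graph_dist E (F (labels i g)) (F (labels i h)) = real (length (X i g) - m' i) + real (length (X i h) - m' i)"
      by metis
    define a where "a i = real (length (X i g) - m i) + real (length (X i h) - m i)" for i
    define a' where "a' i = real (length (X i g) - m' i) + real (length (X i h) - m' i)" for i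
    have N_sum: "real N = (\<Sum>i=1..n. a i)" unfolding a_def sum[symmetric] by simp
    have e: "?e (\<psi> g) (\<psi> h) = (\<Sum>i=1..n. a' i)"
      unfolding l1_dist_def a'_def by (rule sum.cong) (auto simp: \<psi>_def m'(5))
    have m_le: "m i \<le> m' i" for i
      using m'(4)[of i] label_cong[OF m(3), of "m' i" i] m(1,2)[of i] by linarith
    have a_ge: "a' i \<le> a i" for i
      using m_le[of i] by (simp add: a_def a'_def diff_le_mono2 add_mono)
    have upper: "?e (\<psi> g) (\<psi> h) \<le> real N" unfolding e N_sum by (rule sum_mono) (rule a_ge)
    have iso: "?e (\<psi> g) (\<psi> h) = real N" if "N \<le> scale 0"
    proof -
      have "m' i = m i" for i
      proof (rule ccontr)
        assume "m' i \<noteq> m i"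
        then have lt: "m i < m' i" using m_le[of i] by simp
        then have k: "m i < length (X i g)" "m i < length (X i h)" using m'(1,2)[of i] by auto
        have "col (scale 0) (X i g ! m i) = col (scale 0) (X i h ! m i)"
          using label_eq[OF _ _ m'(3)[OF lt]] X[OF g, of i] X[OF h, of i] k by (auto simp: subset_iff)
        then show False using col_ne[OF that order_refl k] by simp
      qed
      then show ?thesis unfolding e N_sum by (simp add: a_def a'_def)
    qed
    have lower: "real N \<le> 2 * ?e (\<psi> g) (\<psi> h)" if N_gt: "\<not> N \<le> scale 0"
    proof -
      \<comment> \<open>The least scale that resolves the distance \<open>N\<close>. It is positive
        because \<open>scale 0 < N\<close>, and minimality gives
        \<open>scale v < 2 * N\<close>.\<close>
      define v where "v = (LEAST v. N \<le> scale v)"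
      have "N \<le> scale N"
      proof -
        have "N \<le> 2 ^ N" by (simp add: less_imp_le)
        moreover have "1 * 2 ^ N \<le> c' * P * 2 ^ N" by (rule mult_le_mono1) (use PP(1) in \<open>simp add: c'_def Suc_le_eq\<close>)
        ultimately show ?thesis unfolding scale_def by linarith
      qed
      then have v: "N \<le> scale v" unfolding v_def by (rule LeastI)
      obtain v' where v': "v = Suc v'" using v N_gt by (cases v) auto
      have "\<not> N \<le> scale v'" using not_less_Least[of v' "\<lambda>v. N \<le> scale v"] v' by (simp add: v_def)
      then have v'': "scale v < 2 * N" by (simp add: scale_def v')
      define b where "b = 2 ^ Suc v * P"
      have b: "b > 0" using PP(1) by (simp add: b_def)
      \<comment> \<open>The first block of length \<open>b\<close> that starts after
        \<open>m i\<close> ends by \<open>m i + 2 * b\<close>. Equal labels throughout it would give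
        its first walls equal colours at scale \<open>v\<close>.\<close>
      have m'_le: "m' i \<le> m i + 2 * b" for i
      proof (rule ccontr)
        assume lt: "\<not> m' i \<le> m i + 2 * b"
        define y where "y = m i div b + 1"
        have "m i div b * b \<le> m i" "m i < y * b"
          using b by (simp_all add: y_def dividend_less_div_times)
        moreover have "Suc y * b = m i div b * b + 2 * b" by (simp add: y_def)
        ultimately have y: "m i \<le> y * b" "Suc y * b \<le> m' i" using lt by linarith+
        then have y': "Suc y * b \<le> length (X i g)" "Suc y * b \<le> length (X i h)" using m'(1,2)[of i] by linarith+
        have "y * b < Suc y * b" using b by simp
        then have k: "y * b < length (X i g)" "y * b < length (X i h)" using y' by linarith+
        have "col (scale v) (X i g ! (y * b)) = col (scale v) (X i h ! (y * b))"
        proof (rule label_block[of "X i g" "X i h" y v, folded b_def])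
          show "label (X i g) k = label (X i h) k" if "k < Suc y * b" for k
            using m'(3)[of k i] that y(2) by linarith
        qed (use X[OF g] X[OF h] y' in auto)
        then show False using col_ne[OF v y(1) k] by simp
      qed
      \<comment> \<open>Each of the two lists loses at most \<open>2 * b\<close> levels.\<close>
      have diff: "a i - a' i \<le> 4 * real b" for i
      proof -
        have "(length (X i g) - m i) + (length (X i h) - m i) \<le>
            (length (X i g) - m' i) + (length (X i h) - m' i) + 4 * b"
          using m'_le[of i] by linarith
        then have "real ((length (X i g) - m i) + (length (X i h) - m i)) \<le>
            real ((length (X i g) - m' i) + (length (X i h) - m' i) + 4 * b)"
          by (simp only: of_nat_le_iff)
        then show ?thesis by (simp add: a_def a'_def)
      qed
      have "(\<Sum>i=1..n. a i) - (\<Sum>i=1..n. a' i) \<le> (\<Sum>i=1..n. 4 * real b)"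
        unfolding sum_subtractf[symmetric] by (rule sum_mono) (rule diff)
      then have gap: "real N - ?e (\<psi> g) (\<psi> h) \<le> 4 * (real n * real b)" unfolding N_sum e by simp
      \<comment> \<open>Hence \<open>32 * n * b \<le> 2 * scale v < 4 * N\<close>, so the loss
        \<open>4 * n * b\<close> is at most \<open>N / 2\<close>.\<close>
      have "c' * b = 2 * scale v" by (simp add: scale_def b_def mult_ac)
      moreover have "32 * n * b \<le> c' * b" by (simp add: c'_def)
      ultimately have "32 * n * b \<le> 4 * N" using v'' by linarith
      then have "real (32 * n * b) \<le> real (4 * N)" by (simp only: of_nat_le_iff)
      then have "32 * (real n * real b) \<le> 4 * real N" by simp
      with gap show ?thesis by linarith
    qed
    have "P \<le> c' * P" by (simp add: c'_def)
    then have "P \<le> scale 0" by (simp add: scale_def)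
    then have "N \<le> scale 0" if "real N \<le> 2 * r" using that PP(2) by linarith
    then show ?thesis unfolding N using upper iso lower by (cases "N \<le> scale 0") auto
  qed
  show ?thesis
  proof (intro exI[of _ \<psi>] conjI ballI)
    show "bilipschitz_embedding (carrier G) ?d ({1..n} \<rightarrow>\<^sub>E V) ?e \<psi>"
      unfolding bilipschitz_embedding_def
    proof (intro conjI exI[of _ "2::real"] ballI)
      fix x y assume xy: "x \<in> carrier G" "y \<in> carrier G"
      have "?e (\<psi> x) (\<psi> y) \<le> ?d x y" "?d x y \<le> 2 * ?e (\<psi> x) (\<psi> y)"
        using main[OF xy] by auto
      moreover have "?d x y \<ge> 0" by simp
      ultimately show "inverse 2 * ?d x y \<le> ?e (\<psi> x) (\<psi> y)"
        "?e (\<psi> x) (\<psi> y) \<le> 2 * ?d x y"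
        by (simp_all add: field_simps)
    qed (use \<psi>_in in auto)
    fix x assume "x \<in> carrier G"
    show "isometric_on (M.mcball x r) ?d ?e \<psi>"
      unfolding isometric_on_def
    proof (intro ballI)
      fix y z assume yz: "y \<in> M.mcball x r" "z \<in> M.mcball x r"
      then have "?d y z \<le> ?d x y + ?d x z" using M.triangle'[of y x z] M.commute by auto
      then have "?d y z \<le> 2 * r" using yz by simp
      then show "?e (\<psi> y) (\<psi> z) = ?d y z" using main[of y z] yz by simp
    qed
  qed
qed

end
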